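(* Let $p<q$ be positive integers with $p+q$ odd and $\gcd(p,q)=1$, and let $L$ be the skew free $(p,q)$-leaper, with even continued fraction $[c_\kappa,\varepsilon_{\kappa-1},c_{\kappa-1},\varepsilon_{\kappa-2},\ldots,c_1]$ and tails the $(p_i,q_i)$-leapers $L_i$. Define boards as follows. (a) Let $A^{\mathcal W}_0$ be a board of size $(p+q)\times(p+q)$. (b) When $\kappa\ge 2$, let $A^{\mathcal W}_1$ be a board of size $(p+q-c_1+1)\times(p+q+q_2-1)$. (c) When $\kappa\ge 3$ and $\varepsilon_1=1$, let $A^{\mathcal W}_2$ be a board of size $(p+q-c_1)\times(p+q+q_3-c_1-1)$. Then, for every board $A$, there exists a wazir journey of $L$ on $A$ if and only if $A^{\mathcal W}_i\sqsubseteq A$ for some $i\in\{0,1,2\}$ for which $A^{\mathcal W}_i$ is defined.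
   Context: A cell is an element of $\mathbb Z^2$. A board of size $m\times n$ ($m$ rows, $n$ columns, $m,n\ge1$) is a product $I_X\times I_Y$ of integer intervals with $|I_X|=n$, $|I_Y|=m$. For boards $A',A''$ of sizes $m'\times n'$ and $m''\times n''$, write $A'\sqsubseteq A''$ if either $m'\le m''$ and $n'\le n''$, or $n'\le m''$ and $m'\le n''$. Two cells $(x',y')$, $(x'',y'')$ are adjacent with respect to the $(p,q)$-leaper when $\{|x'-x''|,|y'-y''|\}=\{p,q\}$. The complete leaper graph of $L$ on $A$ has as vertices all cells of $A$ and as edges all pairs of cells of $A$ adjacent with respect to $L$. The wazir is the $(0,1)$-leaper. A wazir journey of $L$ on $A$ is a walk in the complete leaper graph of $L$ on $A$ whose two endpoints are adjacent with respect to the wazir (i.e. adjacent by side). Even continued fraction: $q/p$ has a unique expansion $c_\kappa+\varepsilon_{\kappa-1}/(c_{\kappa-1}+\varepsilon_{\kappa-2}/(\cdots+\varepsilon_1/c_1))$ with all $c_i$ even positive integers and all $\varepsilon_i\in\{-1,1\}$, written $[c_\kappa,\varepsilon_{\kappa-1},c_{\kappa-1},\varepsilon_{\kappa-2},\ldots,c_1]$. For $1\le i\le\kappa$ the $i$-th tail $L_i$ is the skew free $(p_i,q_i)$-leaper with $p_i<q_i$, $\gcd(p_i,q_i)=1$ and $q_i/p_i=[c_i,\varepsilon_{i-1},c_{i-1},\ldots,c_1]$. *)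

theory Defs
  imports Complex_Main "Graph_Theory.Pair_Digraph" "Graph_Theory.Vertex_Walk"
begin

type_synonym cell = "int \<times> int"

(* m rows and n columns, so the x-range has n elements and the y-range has m. *)
definition is_board :: "int \<Rightarrow> int \<Rightarrow> cell set \<Rightarrow> bool" where
  "is_board m n A \<longleftrightarrow>
     1 \<le> m \<and> 1 \<le> n \<and> (\<exists>a b. A = {a..<a + n} \<times> {b..<b + m})"

definition board_le :: "cell set \<Rightarrow> cell set \<Rightarrow> bool" where
  "board_le A' A'' \<longleftrightarrow>
     (\<exists>m' n' m'' n''. is_board m' n' A' \<and> is_board m'' n'' A'' \<and>
        ((m' \<le> m'' \<and> n' \<le> n'') \<or> (n' \<le> m'' \<and> m' \<le> n'')))"

definition leaper_adj :: "int \<Rightarrow> int \<Rightarrow> cell \<Rightarrow> cell \<Rightarrow> bool" where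
  "leaper_adj p q u v \<longleftrightarrow> {\<bar>fst u - fst v\<bar>, \<bar>snd u - snd v\<bar>} = {p, q}"

(* The undirected leaper graph; each edge is represented by its two opposite arcs. *)
definition leaper_graph :: "int \<Rightarrow> int \<Rightarrow> cell set \<Rightarrow> cell pair_pre_digraph" where
  "leaper_graph p q A =
     \<lparr> pverts = A, parcs = {(u, v). u \<in> A \<and> v \<in> A \<and> leaper_adj p q u v} \<rparr>"

definition wazir_journey :: "int \<Rightarrow> int \<Rightarrow> cell set \<Rightarrow> cell list \<Rightarrow> bool" where
  "wazir_journey p q A ws \<longleftrightarrow>
     vwalk ws (with_proj (leaper_graph p q A)) \<and> leaper_adj 0 1 (hd ws) (last ws)"

(* ecf_value c e i is the value of [c i, e (i - 1), c (i - 1), ..., e 1, c 1].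
   Indices start at 1, at the innermost level; the value at 0 is never used. *)
fun ecf_value :: "(nat \<Rightarrow> int) \<Rightarrow> (nat \<Rightarrow> int) \<Rightarrow> nat \<Rightarrow> rat" where
  "ecf_value c e 0 = 0"
| "ecf_value c e (Suc 0) = of_int (c 1)"
| "ecf_value c e (Suc (Suc i)) =
     of_int (c (Suc (Suc i))) + of_int (e (Suc i)) / ecf_value c e (Suc i)"

definition is_even_cf :: "int \<Rightarrow> int \<Rightarrow> nat \<Rightarrow> (nat \<Rightarrow> int) \<Rightarrow> (nat \<Rightarrow> int) \<Rightarrow> bool" where
  "is_even_cf p q \<kappa> c e \<longleftrightarrow>
     1 \<le> \<kappa> \<and>
     (\<forall>i\<in>{1..\<kappa>}. even (c i) \<and> 0 < c i) \<and>
     (\<forall>i\<in>{1..<\<kappa>}. e i \<in> {-1, 1}) \<and>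
     ecf_value c e \<kappa> = of_int q / of_int p"

(* p' and q' are determined by coprimality and their ratio; the conditions that make
   the (p', q')-leaper skew free hold automatically for an even continued fraction. *)
definition is_tail :: "(nat \<Rightarrow> int) \<Rightarrow> (nat \<Rightarrow> int) \<Rightarrow> nat \<Rightarrow> int \<Rightarrow> int \<Rightarrow> bool" where
  "is_tail c e i p' q' \<longleftrightarrow>
     0 < p' \<and> p' < q' \<and> odd (p' + q') \<and> gcd p' q' = 1 \<and>
     of_int q' / of_int p' = ecf_value c e i"

end

theory Submission
  imports Defs
begin


text \<open>
On the rows 0, ..., p + q - 1 the differences p and q define a single cycle. A board with fewer than
p + q rows therefore projects onto a disjoint union of paths, and parity forces the endpoints of a
journey into one column; they are then joined by one particular arc of the cycle, whose length
is read off the continued fraction, and the arc fits into the rows only if at most c 1 (or c 1 - 1)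
rows are missing.

The number of columns is controlled by passing to tails. If q is an even multiple of p up to a
remainder r, then the walks of the (p, q)-leaper on a board with p + q - d rows and p + q + E columns
correspond to those of the (r, p)-leaper on a board with p + r - d rows and p + r + E columns:
cells in the four corners of the large board are moved together, and sweeps by an even number of
steps across the middle become trivial. Journeys are lifted, and functions that are constant along
walks but separate vertical neighbours are pulled back, from the innermost one, two or three
partial quotients, where both are written down explicitly.
\<close>

section \<open>Boards and walks\<close>

text \<open>The arc joining two vertical neighbours has a length R with p + q = c_1 R + \<epsilon>_1
  B, where 0 < B \<le> R, and d missing rows force d R \<le> p + q - 2. Hence d \<le> c_1, and d =
  c_1 needs \<epsilon>_1 B \<ge> 2. This excludes \<epsilon>_1 = -1, and also \<kappa> = 2, where B
  = 1; so the third board requires \<kappa> \<ge> 3 and \<epsilon>_1 = 1. A tail step preserves the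
  missing rows d and the extra columns E, so the widths are decided at the innermost levels. There
  the only useful device is a double jump by 2 q along a row. Turned into a shift of residues modulo
  p, it has to be available at every residue of a chain. One column less than the stated width
  blocks one link, and an invariant appears. The obstacle to pulling back invariants is a column
  from which a move by q is possible in both directions: it acquires two positions in the tail that
  no tail walk need connect. The invariants therefore carry an additional shift symmetry through the
  induction.\<close>

lemma leaper_adj_iff:
  "leaper_adj p q (x, y) (x', y') \<longleftrightarrow>
     (\<bar>x - x'\<bar> = p \<and> \<bar>y - y'\<bar> = q) \<or> (\<bar>x - x'\<bar> = q \<and> \<bar>y - y'\<bar> = p)"
  by (auto simp: leaper_adj_def doubleton_eq_iff)

definition hop :: "int \<Rightarrow> int \<Rightarrow> cell set \<Rightarrow> cell \<Rightarrow> cell \<Rightarrow> bool" where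
  "hop p q A u v \<longleftrightarrow> u \<in> A \<and> v \<in> A \<and> leaper_adj p q u v"

definition board :: "int \<Rightarrow> int \<Rightarrow> cell set" where
  "board m n = {0..<n} \<times> {0..<m}"

lemma mem_board [simp]: "(x, y) \<in> board m n \<longleftrightarrow> 0 \<le> x \<and> x < n \<and> 0 \<le> y \<and> y < m"
  by (auto simp: board_def)

abbreviation conn :: "int \<Rightarrow> int \<Rightarrow> cell set \<Rightarrow> cell \<Rightarrow> cell \<Rightarrow> bool" where
  "conn p q A \<equiv> (hop p q A)\<^sup>*\<^sup>*"

definition wazir_connected :: "int \<Rightarrow> int \<Rightarrow> cell set \<Rightarrow> bool" where
  "wazir_connected p q A \<longleftrightarrow> (\<exists>u v. u \<in> A \<and> conn p q A u v \<and> leaper_adj 0 1 u v)"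

lemma leaper_adj_sym: "leaper_adj p q u v \<Longrightarrow> leaper_adj p q v u"
  by (simp add: leaper_adj_def abs_minus_commute)

lemma conn_sym: "conn p q A u v \<Longrightarrow> conn p q A v u"
proof (induction rule: rtranclp_induct)
  case (step v w)
  then have "hop p q A w v" by (auto simp: hop_def leaper_adj_sym)
  then show ?case using step by (meson converse_rtranclp_into_rtranclp)
qed simp

lemma conn_trans [trans]: "conn p q A u v \<Longrightarrow> conn p q A v w \<Longrightarrow> conn p q A u w"
  by (rule rtranclp_trans)

lemma conn_mem: "conn p q A u v \<Longrightarrow> u \<in> A \<Longrightarrow> v \<in> A"
  by (induction rule: rtranclp_induct) (auto simp: hop_def)

lemma conn_map:
  assumes "conn p q A u v"
    and "\<And>u v. hop p q A u v \<Longrightarrow> hop p' q' B (f u) (f v)"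
  shows "conn p' q' B (f u) (f v)"
  using assms(1)
proof (induction rule: rtranclp_induct)
  case (step v w)
  then show ?case using assms(2)[of v w] by (meson rtranclp.rtrancl_into_rtrancl)
qed simp

text \<open>The numbers \<open>a\<close> and \<open>b\<close> are arbitrary because the map has to
  preserve adjacency for the leaper and for the wazir alike; inclusions, translations and the
  transposition do.\<close>

lemma wazir_connected_map:
  assumes "wazir_connected p q A"
    and "\<And>u. u \<in> A \<Longrightarrow> f u \<in> B"
    and "\<And>a b u v. leaper_adj a b u v \<Longrightarrow> leaper_adj a b (f u) (f v)"
  shows "wazir_connected p q B"
proof -
  obtain u v where uv: "u \<in> A" "conn p q A u v" "leaper_adj 0 1 u v"
    using assms(1) by (auto simp: wazir_connected_def)
  have "conn p q B (f u) (f v)"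
    by (rule conn_map[OF uv(2)]) (use assms(2,3) in \<open>auto simp: hop_def\<close>)
  then show ?thesis
    unfolding wazir_connected_def using uv assms(2,3) by blast
qed

lemma wazir_connected_mono:
  "wazir_connected p q (board m n) \<Longrightarrow> m \<le> m' \<Longrightarrow> n \<le> n' \<Longrightarrow> wazir_connected p q (board m' n')"
  by (rule wazir_connected_map[of p q "board m n" "\<lambda>u. u"]) (auto simp: board_def)

lemma wazir_connected_swap:
  "wazir_connected p q (board m n) \<Longrightarrow> wazir_connected p q (board n m)"
  by (rule wazir_connected_map[of p q "board m n" prod.swap])
     (auto simp: leaper_adj_iff)

lemma journey_iff_wazir_connected_same:
  "(\<exists>ws. wazir_journey p q A ws) \<longleftrightarrow> wazir_connected p q A"
proof
  assume "\<exists>ws. wazir_journey p q A ws"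
  then obtain ws where ws: "vwalk ws (with_proj (leaper_graph p q A))" "leaper_adj 0 1 (hd ws) (last ws)"
    by (auto simp: wazir_journey_def)
  have "hd ws \<in> A \<and> conn p q A (hd ws) (last ws)"
    using ws(1)
  proof (induction rule: vwalk_induct)
    case (Base u)
    then show ?case by (simp add: leaper_graph_def)
  next
    case (Cons u v es)
    then have "hop p q A u v"
      by (auto simp: hop_def leaper_graph_def arcs_ends_def arc_to_ends_def)
    with Cons show ?case
      by (auto simp: hop_def intro: converse_rtranclp_into_rtranclp)
  qed
  with ws(2) show "wazir_connected p q A"
    unfolding wazir_connected_def by blast
next
  assume "wazir_connected p q A"
  then obtain u v where uv: "u \<in> A" "conn p q A u v" "leaper_adj 0 1 u v"
    by (auto simp: wazir_connected_def)
  have "\<exists>ws. vwalk ws (with_proj (leaper_graph p q A)) \<and> hd ws = u \<and> last ws = v"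
    using uv(2,1)
  proof (induction rule: converse_rtranclp_induct)
    case base
    then show ?case by (intro exI[of _ "[v]"]) (auto simp: vwalk_def leaper_graph_def)
  next
    case (step u w)
    then obtain ws where ws: "vwalk ws (with_proj (leaper_graph p q A))" "hd ws = w" "last ws = v"
      by (auto simp: hop_def)
    with step have "vwalk (u # ws) (with_proj (leaper_graph p q A))"
      by (intro vwalk_consI) (auto simp: vwalk_def hop_def leaper_graph_def arcs_ends_def arc_to_ends_def)
    with ws show ?case by (intro exI[of _ "u # ws"]) (auto simp: vwalk_def)
  qed
  with uv(3) show "\<exists>ws. wazir_journey p q A ws"
    by (auto simp: wazir_journey_def)
qed

lemma journey_iff_wazir_connected:
  assumes "is_board m n A"
  shows "(\<exists>ws. wazir_journey p q A ws) \<longleftrightarrow> wazir_connected p q (board m n)"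
proof -
  obtain a b where A: "A = {a..<a + n} \<times> {b..<b + m}"
    using assms by (auto simp: is_board_def)
  have adj: "leaper_adj k l (x - s, y - t) (x' - s, y' - t) \<longleftrightarrow> leaper_adj k l (x, y) (x', y')"
    for k l x y x' y' s t by (simp add: leaper_adj_def)
  have "wazir_connected p q (board m n)" if *: "wazir_connected p q A"
    by (rule wazir_connected_map[OF *, of "\<lambda>(x, y). (x - a, y - b)"])
       (auto simp: A adj )
  moreover have "wazir_connected p q A" if *: "wazir_connected p q (board m n)"
    by (rule wazir_connected_map[OF *, of "\<lambda>(x, y). (x - (- a), y - (- b))"])
       (auto simp: A adj simp del: diff_minus_eq_add)
  ultimately show ?thesis
    unfolding journey_iff_wazir_connected_same by blast
qed

lemma is_board_unique:
  assumes "is_board m n A" "is_board m' n' A"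
  shows "m = m'" "n = n'"
proof -
  from assms obtain a b a' b' where *: "1 \<le> m" "1 \<le> n" "1 \<le> m'" "1 \<le> n'"
    "A = {a..<a + n} \<times> {b..<b + m}" "A = {a'..<a' + n'} \<times> {b'..<b' + m'}"
    unfolding is_board_def by blast
  have "{a..<a + n} \<times> {b..<b + m} = {a'..<a' + n'} \<times> {b'..<b' + m'}"
    using * by simp
  then have "{a..<a + n} = {a'..<a' + n'} \<and> {b..<b + m} = {b'..<b' + m'}"
    using * by (simp add: times_eq_iff)
  then have "card {a..<a + n} = card {a'..<a' + n'} \<and> card {b..<b + m} = card {b'..<b' + m'}" by simp
  then show "m = m'" "n = n'" using * by auto
qed

lemma board_le_iff:
  assumes "is_board m' n' A'" "is_board m n A"
  shows "board_le A' A \<longleftrightarrow> (m' \<le> m \<and> n' \<le> n) \<or> (n' \<le> m \<and> m' \<le> n)"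
proof
  assume "board_le A' A"
  then obtain m1 n1 m2 n2 where "is_board m1 n1 A'" "is_board m2 n2 A"
    "(m1 \<le> m2 \<and> n1 \<le> n2) \<or> (n1 \<le> m2 \<and> m1 \<le> n2)"
    by (auto simp: board_le_def)
  moreover from this have "m1 = m'" "n1 = n'" "m2 = m" "n2 = n"
    using assms is_board_unique by metis+
  ultimately show "(m' \<le> m \<and> n' \<le> n) \<or> (n' \<le> m \<and> m' \<le> n)" by simp
qed (use assms in \<open>auto simp: board_le_def\<close>)


section \<open>Lifting journeys from the tail\<close>

text \<open>On fewer than p + q rows a parity invariant rules out horizontal neighbours
  (\<open>wazir_imp_vertically_connected\<close>), and the vertical form is the one that passes
  through a tail step.\<close>

definition vertically_connected :: "int \<Rightarrow> int \<Rightarrow> cell set \<Rightarrow> bool" where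
  "vertically_connected p q A \<longleftrightarrow> (\<exists>x y. (x, y) \<in> A \<and> conn p q A (x, y) (x, y + 1))"

lemma vertically_connected_imp_wazir:
  "vertically_connected p q A \<Longrightarrow> wazir_connected p q A"
  unfolding vertically_connected_def wazir_connected_def
  by (force simp: leaper_adj_iff)

lemma sweep_nat:
  fixes p q x y s :: int
  assumes "0 < p" "0 < q" "0 \<le> x" "x + q < n" "0 \<le> y"
  shows "y + int k * p < m \<Longrightarrow>
    conn p q (board m n) (x + (s mod 2) * q, y) (x + ((s + int k) mod 2) * q, y + int k * p)"
proof (induction k)
  case (Suc k)
  have le: "y + int k * p < m" using Suc.prems assms(1) by (simp add: algebra_simps)
  have s2: "(s + int k) mod 2 = 0 \<and> (s + int (Suc k)) mod 2 = 1 \<or>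
            (s + int k) mod 2 = 1 \<and> (s + int (Suc k)) mod 2 = 0" by presburger
  have "0 \<le> int k * p" using assms by simp
  then have "hop p q (board m n) (x + ((s + int k) mod 2) * q, y + int k * p)
     (x + ((s + int (Suc k)) mod 2) * q, y + int (Suc k) * p)"
    using s2 assms Suc.prems le by (auto simp: hop_def leaper_adj_iff algebra_simps)
  with Suc.IH[OF le] show ?case by (meson rtranclp.rtrancl_into_rtrancl)
qed simp

text \<open>Moving p rows at a time while jumping back and forth between the columns x and x + q.\<close>

lemma sweep_y:
  fixes p q x y s j :: int
  assumes "0 < p" "0 < q" "0 \<le> x" "x + q < n" "0 \<le> y" "y < m" "0 \<le> y'" "y' < m"
    and "y' = y + j * p" "even (s + s' + j)" "s = 0 \<or> s = 1" "s' = 0 \<or> s' = 1"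
  shows "conn p q (board m n) (x + s * q, y) (x + s' * q, y')"
proof (cases "j \<ge> 0")
  case True
  have "(s + j) mod 2 = s'" "s mod 2 = s" using assms(10-12) by presburger+
  with sweep_nat[of p q x n y "nat j" m s] True assms(1-9) show ?thesis by simp
next
  case False
  have "(s' + - j) mod 2 = s" "s' mod 2 = s'" using assms(10-12) by presburger+
  with sweep_nat[of p q x n y' "nat (- j)" m s'] False assms(1-9) have
    "conn p q (board m n) (x + s' * q, y') (x + s * q, y)" by simp
  then show ?thesis by (rule conn_sym)
qed

lemma conn_swap:
  assumes "conn p q (board m n) (x, y) (x', y')"
  shows "conn p q (board n m) (y, x) (y', x')"
proof -
  have "conn p q (board n m) (prod.swap (x, y)) (prod.swap (x', y'))"
    by (rule conn_map[OF assms]) (auto simp: hop_def leaper_adj_iff)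
  then show ?thesis by simp
qed

lemma sweep_x:
  fixes p q x y s j :: int
  assumes "0 < p" "0 < q" "0 \<le> y" "y + q < m" "0 \<le> x" "x < n" "0 \<le> x'" "x' < n"
    and "x' = x + j * p" "even (s + s' + j)" "s = 0 \<or> s = 1" "s' = 0 \<or> s' = 1"
  shows "conn p q (board m n) (x, y + s * q) (x', y + s' * q)"
  by (rule conn_swap) (rule sweep_y[OF assms])

text \<open>
The (r, p)-leaper is the tail of the (p, q)-leaper, and the two boards have C + r rows and D + r columns,
and C + q rows and D + q columns. Only columns in one of the intervals [0, D) and [q, q + D) admit
a move by q; in the tail these two intervals start at lam and mu, so their distance shrinks from q to r
and they overlap. The remainder is mu - lam, which is r or -r. The same holds for rows with C.
\<close>

locale tail_step =
  fixes p q r c lam mu C D :: int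
  assumes r: "0 < r" "r < p" and c: "even c" "2 \<le> c" and q: "q = c * p + mu - lam"
    and lm: "(lam = 0 \<and> mu = r) \<or> (lam = r \<and> mu = 0)"
    and CD: "0 < C" "r \<le> D"
begin

lemma p_less_q: "p < q"
proof -
  have "2 * p \<le> c * p" using c r by (intro mult_right_mono) auto
  then show ?thesis using q lm r by linarith
qed

lemma pos: "0 < p" "0 < q"
  using r p_less_q by auto

text \<open>The offset in the tail of the low (\<open>s = 0\<close>) or high (\<open>s = 1\<close>)
  interval. Being affine in the bit, it turns comparisons of positions into ring identities with q =
  c p + mu - lam.\<close>

definition off :: "int \<Rightarrow> int" where
  "off s = lam + s * (mu - lam)"

text \<open>A relation, not a map: in the tail the intervals overlap, so a cell can come from up to
  four corners, while a row between C and r comes from none when C < r.\<close>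

definition rep :: "cell \<Rightarrow> cell \<Rightarrow> bool" where
  "rep T u \<longleftrightarrow> (\<exists>x y s t. 0 \<le> x \<and> x < D \<and> 0 \<le> y \<and> y < C \<and> (s = 0 \<or> s = 1) \<and> (t = 0 \<or> t = 1) \<and>
    T = (x + off s, y + off t) \<and> u = (x + s * q, y + t * q))"

lemma repI:
  "0 \<le> x \<Longrightarrow> x < D \<Longrightarrow> 0 \<le> y \<Longrightarrow> y < C \<Longrightarrow> s = 0 \<or> s = 1 \<Longrightarrow> t = 0 \<or> t = 1 \<Longrightarrow>
    X = x + off s \<Longrightarrow> Y = y + off t \<Longrightarrow> u = x + s * q \<Longrightarrow> v = y + t * q \<Longrightarrow> rep (X, Y) (u, v)"
  unfolding rep_def by blast

lemma repE:
  assumes "rep (X, Y) u"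
  obtains x y s t where "0 \<le> x" "x < D" "0 \<le> y" "y < C" "s = 0 \<or> s = 1" "t = 0 \<or> t = 1"
    "X = x + off s" "Y = y + off t" "u = (x + s * q, y + t * q)"
  using assms unfolding rep_def by blast

lemma bit_bounds: "s = 0 \<or> s = 1 \<Longrightarrow> 0 \<le> s * q \<and> s * q \<le> q"
  using pos by auto

text \<open>Two origins of one tail coordinate differ by 0 or c p in absolute value. As c is even, a
  sweep of c steps comes back to the line on which it started.\<close>

lemma rep_conn:
  assumes "rep T u" "rep T v"
  shows "conn p q (board (C + q) (D + q)) u v"
proof -
  obtain X0 Y0 where T: "T = (X0, Y0)" by fastforce
  obtain x y s t where 1: "0 \<le> x" "x < D" "0 \<le> y" "y < C" "s = 0 \<or> s = 1" "t = 0 \<or> t = 1"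
    "X0 = x + off s" "Y0 = y + off t" "u = (x + s * q, y + t * q)"
    using assms(1) unfolding T by (rule repE)
  obtain x' y' s' t' where 2: "0 \<le> x'" "x' < D" "0 \<le> y'" "y' < C" "s' = 0 \<or> s' = 1" "t' = 0 \<or> t' = 1"
    "X0 = x' + off s'" "Y0 = y' + off t'" "v = (x' + s' * q, y' + t' * q)"
    using assms(2) unfolding T by (rule repE)
  note b = 1(1-4) 2(1-4) bit_bounds[OF 1(5)] bit_bounds[OF 1(6)] bit_bounds[OF 2(5)] bit_bounds[OF 2(6)]
  have X: "x' + s' * q = x + s * q + ((s' - s) * c) * p"
    using 1(7) 2(7) unfolding off_def q by (simp add: algebra_simps)
  have Y: "y' + t' * q = y + t * q + ((t' - t) * c) * p"
    using 1(8) 2(8) unfolding off_def q by (simp add: algebra_simps)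
  have "conn p q (board (C + q) (D + q)) (x + s * q, y + t * q) (x' + s' * q, y + t * q)"
    by (rule sweep_x[OF pos _ _ _ _ _ _ X _ 1(6) 1(6)], (use b in linarith)+) (use c in simp)
  also have "conn p q (board (C + q) (D + q)) (x' + s' * q, y + t * q) (x' + s' * q, y' + t' * q)"
    by (rule sweep_y[OF pos _ _ _ _ _ _ Y _ 2(5) 2(5)], (use b in linarith)+) (use c in simp)
  finally show ?thesis using 1 2 by simp
qed

lemma off_simps: "off 0 = lam" "off 1 = mu"
  by (simp_all add: off_def)

lemma off_cases:
  obtains s where "off s = 0" "off (1 - s) = r" "s = 0 \<or> s = 1" "r = (1 - 2 * s) * (mu - lam)"
proof (cases "lam = 0")
  case True
  then have "mu = r" using lm r by auto
  with True off_simps show ?thesis by (intro that[of 0]) simp_all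
next
  case False
  then have "lam = r" "mu = 0" using lm by auto
  with off_simps show ?thesis by (intro that[of 1]) simp_all
qed

lemma x_rep:
  assumes "0 \<le> x" "x < D + r"
  obtains x0 t where "0 \<le> x0" "x0 < D" "x = x0 + off t" "t = 0 \<or> t = 1"
proof -
  obtain s where s: "off s = 0" "off (1 - s) = r" "s = 0 \<or> s = 1" by (rule off_cases)
  show ?thesis
  proof (cases "x < D")
    case True
    then show ?thesis using that[of x s] s assms by auto
  next
    case False
    then show ?thesis using that[of "x - r" "1 - s"] s assms CD by auto
  qed
qed

text \<open>The displacement j p may gain or lose c p on the large board and remains an odd multiple
  of p. The sweep thus ends in the other one of the rows y and y + q, and this change of row is the
  tail's move by r.\<close>

lemma rep_step_x:
  assumes "0 \<le> y" "y < C" "0 \<le> x" "x < D + r" "0 \<le> x'" "x' < D + r" "x' = x + j * p" "odd j"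
  shows "\<exists>u v. rep (x, y) u \<and> rep (x', y + r) v \<and> conn p q (board (C + q) (D + q)) u v"
proof -
  obtain s where s: "off s = 0" "off (1 - s) = r" "s = 0 \<or> s = 1" by (rule off_cases)
  obtain x0 t where x0: "0 \<le> x0" "x0 < D" "x = x0 + off t" "t = 0 \<or> t = 1"
    using assms(3,4) by (rule x_rep)
  obtain x1 t' where x1: "0 \<le> x1" "x1 < D" "x' = x1 + off t'" "t' = 0 \<or> t' = 1"
    using assms(5,6) by (rule x_rep)
  have s': "1 - s = 0 \<or> 1 - s = 1" using s by auto
  have X: "x1 + t' * q = x0 + t * q + (j + (t' - t) * c) * p"
    using assms(7) x0(3) x1(3) unfolding off_def q by (simp add: algebra_simps)
  have "conn p q (board (C + q) (D + q)) (x0 + t * q, y + s * q) (x1 + t' * q, y + (1 - s) * q)"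
    by (rule sweep_x[OF pos _ _ _ _ _ _ X _ s(3) s'],
        (use x0(1,2) x1(1,2) assms(1,2) bit_bounds[OF x0(4)] bit_bounds[OF x1(4)] in linarith)+)
       (use c assms(8) in simp)
  moreover have "rep (x, y) (x0 + t * q, y + s * q)"
    by (rule repI[of x0 y t s]) (use x0 assms s in simp_all)
  moreover have "rep (x', y + r) (x1 + t' * q, y + (1 - s) * q)"
    by (rule repI[of x1 y t' "1 - s"]) (use x1 assms s s' in simp_all)
  ultimately show ?thesis by blast
qed

text \<open>Since r < p, the lower row can be represented at offset 0 and the upper one at offset r,
  that is, at opposite ends of the large board. The sweep between them takes 1 + c or 1 - c steps,
  an odd number, so it also exchanges the two column intervals.\<close>

lemma rep_step_y:
  assumes "0 \<le> x" "x < D" "0 \<le> y" "y + p < C + r"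
  shows "\<exists>u v. rep (x, y) u \<and> rep (x + r, y + p) v \<and> conn p q (board (C + q) (D + q)) u v"
    and "\<exists>u v. rep (x, y + p) u \<and> rep (x + r, y) v \<and> conn p q (board (C + q) (D + q)) u v"
proof -
  obtain s where s: "off s = 0" "off (1 - s) = r" "s = 0 \<or> s = 1" "r = (1 - 2 * s) * (mu - lam)"
    by (rule off_cases)
  have s': "1 - s = 0 \<or> 1 - s = 1" using s(3) by auto
  have Y: "y + p - r + (1 - s) * q = y + s * q + (1 + (1 - 2 * s) * c) * p"
    unfolding s(4) q by (simp add: algebra_simps)
  note b = bit_bounds[OF s(3)] bit_bounds[OF s']
  have *: "conn p q (board (C + q) (D + q)) (x + a * q, y + s * q)
      (x + (1 - a) * q, y + p - r + (1 - s) * q)" if "a = 0 \<or> a = 1" for a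
    by (rule sweep_y[OF pos _ _ _ _ _ _ Y _ that], (use r assms b in linarith)+)
       (use c that in auto)
  have rep1: "rep (x + off a, y) (x + a * q, y + s * q)" if "a = 0 \<or> a = 1" for a
    by (rule repI[of x y a s]) (use assms s(1,3) r that in simp_all)
  have rep2: "rep (x + off a, y + p) (x + a * q, y + p - r + (1 - s) * q)" if "a = 0 \<or> a = 1" for a
    by (rule repI[of x "y + p - r" a "1 - s"]) (use assms s(2) s' r that in simp_all)
  show "\<exists>u v. rep (x, y) u \<and> rep (x + r, y + p) v \<and> conn p q (board (C + q) (D + q)) u v"
    using rep1[OF s(3)] rep2[OF s'] *[OF s(3)] s(1,2) by auto
  show "\<exists>u v. rep (x, y + p) u \<and> rep (x + r, y) v \<and> conn p q (board (C + q) (D + q)) u v"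
    using rep2[OF s(3)] rep1[OF s'] conn_sym[OF *[OF s']] s(1,2) by auto
qed

lemma rep_hop:
  assumes "hop r p (board (C + r) (D + r)) T T'"
  shows "\<exists>u v. rep T u \<and> rep T' v \<and> conn p q (board (C + q) (D + q)) u v"
proof -
  obtain x y x' y' where T: "T = (x, y)" "T' = (x', y')" by (metis surj_pair)
  have b: "0 \<le> x" "x < D + r" "0 \<le> y" "y < C + r" "0 \<le> x'" "x' < D + r" "0 \<le> y'" "y' < C + r"
    and adj: "(\<bar>x - x'\<bar> = r \<and> \<bar>y - y'\<bar> = p) \<or> (\<bar>x - x'\<bar> = p \<and> \<bar>y - y'\<bar> = r)"
    using assms by (auto simp: hop_def T leaper_adj_iff)
  let ?P = "\<lambda>T T'. \<exists>u v. rep T u \<and> rep T' v \<and> conn p q (board (C + q) (D + q)) u v"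
  have sym: "?P T T' \<Longrightarrow> ?P T' T" for T T' using conn_sym by blast
  consider (a) "x' = x + r" "y' = y + p" | (b) "x' = x + r" "y = y' + p"
    | (c) "x = x' + r" "y' = y + p" | (d) "x = x' + r" "y = y' + p"
    | (e) "y' = y + r" "x' = x + 1 * p" | (f) "y = y' + r" "x = x' + 1 * p"
    | (g) "y' = y + r" "x' = x + - 1 * p" | (h) "y = y' + r" "x = x' + - 1 * p"
  proof -
    have abs: "\<bar>a - b\<bar> = k \<longleftrightarrow> b = a + k \<and> 0 \<le> k \<or> a = b + k \<and> 0 \<le> k" for a b k :: int by linarith
    have "x' = x + r \<or> x = x' + r" "y' = y + p \<or> y = y' + p" if "\<bar>x - x'\<bar> = r \<and> \<bar>y - y'\<bar> = p"
      using that unfolding abs by blast+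
    moreover have "x' = x + 1 * p \<or> x' = x + - 1 * p" "x = x' + 1 * p \<or> x = x' + - 1 * p"
      "y' = y + r \<or> y = y' + r" if "\<bar>x - x'\<bar> = p \<and> \<bar>y - y'\<bar> = r"
      using that unfolding abs by auto
    ultimately show ?thesis using adj that by meson
  qed
  then show ?thesis
  proof cases
    case a then show ?thesis using rep_step_y(1)[of x y] b T by simp
  next
    case b with \<open>0 \<le> y'\<close> \<open>y < C + r\<close> \<open>0 \<le> x\<close> \<open>x' < D + r\<close> show ?thesis
      using rep_step_y(2)[of x y'] T by simp
  next
    case c with \<open>0 \<le> y\<close> \<open>y' < C + r\<close> \<open>0 \<le> x'\<close> \<open>x < D + r\<close>
    have "?P (x', y + p) (x' + r, y)" by (intro rep_step_y(2)) auto
    then show ?thesis using c T sym by simp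
  next
    case d with b have "?P (x', y') (x' + r, y' + p)" by (intro rep_step_y(1)) auto
    then show ?thesis using d T sym by simp
  next
    case e
    then show ?thesis using rep_step_x[OF _ _ b(1,2,5,6) e(2)] b T by simp
  next
    case f
    then have "?P (x', y') (x, y' + r)" using rep_step_x[OF _ _ b(5,6,1,2) f(2)] b by simp
    then show ?thesis using f T sym by simp
  next
    case g
    then show ?thesis using rep_step_x[OF _ _ b(1,2,5,6) g(2)] b T by simp
  next
    case h
    then have "?P (x', y') (x, y' + r)" using rep_step_x[OF _ _ b(5,6,1,2) h(2)] b by simp
    then show ?thesis using h T sym by simp
  qed
qed

text \<open>Tail cells without a representative are isolated; \<open>T \<noteq> T'\<close>
  guarantees a first move, and with it representatives for all cells of the walk.\<close>

lemma rep_walk: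
  assumes "conn r p (board (C + r) (D + r)) T T'" "T \<noteq> T'"
  shows "\<exists>u v. rep T u \<and> rep T' v \<and> conn p q (board (C + q) (D + q)) u v"
  using assms
proof (induction rule: rtranclp_induct)
  case (step T1 T2)
  obtain u1 u2 where u: "rep T1 u1" "rep T2 u2" "conn p q (board (C + q) (D + q)) u1 u2"
    using rep_hop[OF step.hyps(2)] by blast
  show ?case
  proof (cases "T = T1")
    case True
    then show ?thesis using u by blast
  next
    case False
    then obtain v v1 where v: "rep T v" "rep T1 v1" "conn p q (board (C + q) (D + q)) v v1"
      using step.IH by blast
    then have "conn p q (board (C + q) (D + q)) v u2"
      using rep_conn[OF v(2) u(1)] u(3) by (meson conn_trans)
    then show ?thesis using v u by blast
  qed
qed simp

text \<open>
The two ends of a tail journey may have representatives in different corners; a sweep brings both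
into adjacent rows.
\<close>

lemma rep_shift:
  assumes rep: "rep (x0 + off s, Y) u" and x0: "0 \<le> x0" "x0 < D" and s: "s = 0 \<or> s = 1" "s' = 0 \<or> s' = 1"
    and y: "y = Y - lam + j * p" "0 \<le> y" "y < C + q" and ev: "even (s + s' + j)"
  shows "conn p q (board (C + q) (D + q)) u (x0 + s' * q, y)"
proof -
  obtain y0 t where y0: "0 \<le> y0" "y0 < C" "t = 0 \<or> t = 1" "Y = y0 + off t"
    using rep by (rule repE)
  have "rep (x0 + off s, Y) (x0 + s * q, y0 + t * q)"
    by (rule repI) (use x0 y0 s in simp_all)
  then have "conn p q (board (C + q) (D + q)) u (x0 + s * q, y0 + t * q)"
    using rep rep_conn by blast
  moreover
  have Y: "y = y0 + t * q + (j - t * c) * p"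
    using y0(4) y(1) unfolding off_def q by (simp add: algebra_simps)
  have "conn p q (board (C + q) (D + q)) (x0 + s * q, y0 + t * q) (x0 + s' * q, y)"
    by (rule sweep_y[OF pos _ _ _ _ _ _ Y _ s],
        (use x0 y0(1,2) y(2,3) bit_bounds[OF y0(3)] in linarith)+) (use c ev in simp)
  ultimately show ?thesis by (meson conn_trans)
qed

lemma vertically_connected_lift:
  assumes "vertically_connected r p (board (C + r) (D + r))"
  shows "vertically_connected p q (board (C + q) (D + q))"
proof -
  obtain X Y where XY: "(X, Y) \<in> board (C + r) (D + r)"
    "conn r p (board (C + r) (D + r)) (X, Y) (X, Y + 1)"
    using assms by (auto simp: vertically_connected_def)
  have XY': "(X, Y + 1) \<in> board (C + r) (D + r)" using conn_mem XY by blast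
  obtain u v where uv: "rep (X, Y) u" "rep (X, Y + 1) v" "conn p q (board (C + q) (D + q)) u v"
    using rep_walk[OF XY(2)] by auto
  obtain x0 s where x0: "0 \<le> x0" "x0 < D" "X = x0 + off s" "s = 0 \<or> s = 1"
    using uv(1) by (rule repE)
  \<comment> \<open>For lam = r a row Y < r would be sent below row 0. One more step of p repairs
    this, and \<open>s'\<close> compensates its parity.\<close>
  obtain j where j: "j = 0 \<or> j = 1" "0 \<le> Y - lam + j * p" "Y + 1 - lam + j * p < C + q"
  proof (cases "lam \<le> Y")
    case True
    then show ?thesis using that[of 0] XY' lm p_less_q r by auto
  next
    case False
    then show ?thesis using that[of 1] XY XY' lm p_less_q r CD by auto
  qed
  obtain s' where s': "s' = 0 \<or> s' = 1" "even (s + s' + j)"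
    using x0(4) j(1) that[of 0] that[of 1] by auto
  have "conn p q (board (C + q) (D + q)) u (x0 + s' * q, Y - lam + j * p)"
    by (rule rep_shift[OF _ x0(1,2,4) s'(1) refl _ _ s'(2)]) (use uv(1) j x0(3) in auto)
  moreover have "conn p q (board (C + q) (D + q)) v (x0 + s' * q, Y + 1 - lam + j * p)"
    by (rule rep_shift[OF _ x0(1,2,4) s'(1) refl _ _ s'(2)]) (use uv(2) j x0(3) in auto)
  ultimately have "conn p q (board (C + q) (D + q)) (x0 + s' * q, Y - lam + j * p)
      (x0 + s' * q, Y + 1 - lam + j * p)"
    using uv(3) conn_sym conn_trans by meson
  moreover have "Y + 1 - lam + j * p = Y - lam + j * p + 1" by simp
  moreover have "(x0 + s' * q, Y - lam + j * p) \<in> board (C + q) (D + q)"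
    using x0(1,2) j bit_bounds[OF s'(1)] by simp
  ultimately show ?thesis unfolding vertically_connected_def by metis
qed

end


section \<open>Separating functions\<close>

definition separator :: "int \<Rightarrow> int \<Rightarrow> int \<Rightarrow> int \<Rightarrow> (cell \<Rightarrow> int \<times> int) \<Rightarrow> int \<Rightarrow> bool" where
  "separator p q m n F B \<longleftrightarrow>
     (\<forall>u v. hop p q (board m n) u v \<longrightarrow> F u = F v) \<and>
     (\<forall>x y. (x, y) \<in> board m n \<and> (x, y + 1) \<in> board m n \<longrightarrow> F (x, y) \<noteq> F (x, y + 1)) \<and>
     (2 * q < n \<longrightarrow> (\<forall>x y. p \<le> x \<and> x < n - 2 * q + p \<and> m - q \<le> y \<and> y < q \<longrightarrow>
        F (x, y) = F (x + 2 * (q - p), y))) \<and>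
     (\<forall>u \<in> board m n. fst (F u) < B)"

text \<open>
The third clause strengthens the induction: it is needed exactly when some column x and x + 2 q both
lie on the board, so that two consecutive moves connect them. The bound B leaves a fresh
value for the isolated cells of the next board.
\<close>

lemma separator_conn:
  assumes "separator p q m n F B" "conn p q (board m n) u v"
  shows "F u = F v"
  using assms(2)
proof (induction rule: rtranclp_induct)
  case (step v w)
  have "F v = F w" using assms(1) step.hyps(2) unfolding separator_def by blast
  then show ?case using step.IH by simp
qed simp

lemma separator_shift:
  assumes "separator p q m n F B" "2 * q < n" "p \<le> x" "x < n - 2 * q + p" "m - q \<le> y" "y < q"
  shows "F (x, y) = F (x + 2 * (q - p), y)"
  using assms unfolding separator_def by blast

lemma separator_imp_not_vertically_connected:
  assumes "separator p q m n F B"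
  shows "\<not> vertically_connected p q (board m n)"
proof
  assume "vertically_connected p q (board m n)"
  then obtain x y where xy: "(x, y) \<in> board m n" "conn p q (board m n) (x, y) (x, y + 1)"
    by (auto simp: vertically_connected_def)
  then have "(x, y + 1) \<in> board m n" using conn_mem by blast
  moreover have "F (x, y) = F (x, y + 1)" using separator_conn[OF assms xy(2)] .
  ultimately show False using assms xy(1) unfolding separator_def by blast
qed

lemma hop_pqI:
  assumes "(x, y) \<in> A" "(x', y') \<in> A" "x' = x + p \<or> x' = x - p" "y' = y + q \<or> y' = y - q" "0 < p" "0 < q"
  shows "hop p q A (x, y) (x', y')"
  using assms unfolding hop_def leaper_adj_iff by auto

lemma hop_qpI:
  assumes "(x, y) \<in> A" "(x', y') \<in> A" "x' = x + q \<or> x' = x - q" "y' = y + p \<or> y' = y - p" "0 < p" "0 < q"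
  shows "hop p q A (x, y) (x', y')"
  using assms unfolding hop_def leaper_adj_iff by auto

lemma hop_commute: "hop p q = hop q p"
  by (intro ext) (simp add: hop_def leaper_adj_def insert_commute)

section \<open>Pulling separating functions back along a tail step\<close>

context tail_step
begin

text \<open>For remainder -r the tail places the low interval above the high one, so the bits are
  exchanged. Parities of sums of two bits do not notice this.\<close>

definition flip :: "int \<Rightarrow> int" where
  "flip s = (if lam = 0 then s else 1 - s)"

lemma off_flip: "s = 0 \<or> s = 1 \<Longrightarrow> off s = flip s * r"
  using lm r by (auto simp: off_def flip_def)

lemma flip_bit: "s = 0 \<or> s = 1 \<Longrightarrow> flip s = 0 \<or> flip s = 1"
  by (auto simp: flip_def)

lemma flip_parity: "even (flip s + flip s' + k) \<longleftrightarrow> even (s + s' + k)"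
  by (simp add: flip_def)

lemma tail_sweep_y:
  assumes "0 \<le> x" "x < D" "0 \<le> y" "y < C + r" "0 \<le> y'" "y' < C + r"
    and "y' = y + j * p" "even (s + s' + j)" "s = 0 \<or> s = 1" "s' = 0 \<or> s' = 1"
  shows "conn r p (board (C + r) (D + r)) (x + off s, y) (x + off s', y')"
  unfolding hop_commute[of r p] off_flip[OF assms(9)] off_flip[OF assms(10)]
  by (rule sweep_y) (use assms pos r flip_parity flip_bit in auto)

lemma tail_sweep_x:
  assumes "0 \<le> y" "y < C" "0 \<le> x" "x < D + r" "0 \<le> x'" "x' < D + r"
    and "x' = x + j * p" "even (s + s' + j)" "s = 0 \<or> s = 1" "s' = 0 \<or> s' = 1"
  shows "conn r p (board (C + r) (D + r)) (x, y + off s) (x', y + off s')"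
  unfolding hop_commute[of r p] off_flip[OF assms(9)] off_flip[OF assms(10)]
  by (rule sweep_x) (use assms pos r flip_parity flip_bit in auto)

text \<open>
Tags generalise representatives to cells outside the corners: such a cell is first swept by j
steps onto a row (column) of the tail board.
\<close>

inductive tag_y :: "cell \<Rightarrow> cell \<Rightarrow> bool" where
  "0 \<le> x \<Longrightarrow> x < D \<Longrightarrow> s = 0 \<or> s = 1 \<Longrightarrow> w = 0 \<or> w = 1 \<Longrightarrow> even (s + w + j) \<Longrightarrow>
    0 \<le> y - j * p + lam \<Longrightarrow> y - j * p + lam < C + r \<Longrightarrow>
    tag_y (x + s * q, y) (x + off w, y - j * p + lam)"

inductive tag_x :: "cell \<Rightarrow> cell \<Rightarrow> bool" where
  "0 \<le> y \<Longrightarrow> y < C \<Longrightarrow> s = 0 \<or> s = 1 \<Longrightarrow> w = 0 \<or> w = 1 \<Longrightarrow> even (s + w + j) \<Longrightarrow>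
    0 \<le> x - j * p + lam \<Longrightarrow> x - j * p + lam < D + r \<Longrightarrow>
    tag_x (x, y + s * q) (x - j * p + lam, y + off w)"

lemma tag_y_conn:
  assumes "0 \<le> x" "x < D" "s = 0 \<or> s = 1"
    and "w = 0 \<or> w = 1" "even (s + w + j)" "0 \<le> y - j * p + lam" "y - j * p + lam < C + r"
    and "w' = 0 \<or> w' = 1" "even (s + w' + j')" "0 \<le> y - j' * p + lam" "y - j' * p + lam < C + r"
  shows "conn r p (board (C + r) (D + r)) (x + off w, y - j * p + lam) (x + off w', y - j' * p + lam)"
  by (rule tail_sweep_y[where j = "j - j'"]) (use assms in \<open>auto simp: algebra_simps\<close>)

lemma tag_x_conn:
  assumes "0 \<le> y" "y < C" "s = 0 \<or> s = 1"
    and "w = 0 \<or> w = 1" "even (s + w + j)" "0 \<le> x - j * p + lam" "x - j * p + lam < D + r"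
    and "w' = 0 \<or> w' = 1" "even (s + w' + j')" "0 \<le> x - j' * p + lam" "x - j' * p + lam < D + r"
  shows "conn r p (board (C + r) (D + r)) (x - j * p + lam, y + off w) (x - j' * p + lam, y + off w')"
  by (rule tail_sweep_x[where j = "j - j'"]) (use assms in \<open>auto simp: algebra_simps\<close>)

lemma off_bounds: "s = 0 \<or> s = 1 \<Longrightarrow> 0 \<le> off s \<and> off s \<le> r"
  using off_flip flip_bit r by (smt (verit) mult_cancel_right1 mult_eq_0_iff)

text \<open>A cell with tags of both kinds lies in a corner (x + s q, y0 + t q). Its ordinary tail
  position is itself a tag of either kind, for t c and s c steps, and links the two.\<close>

lemma tag_y_tag_x_conn:
  assumes "tag_y u v" "tag_x u v'"
  shows "conn r p (board (C + r) (D + r)) v v'"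
  using assms
proof (cases rule: tag_y.cases)
  case (1 x s w j y)
  note A = 1
  from assms(2) show ?thesis
  proof (cases rule: tag_x.cases)
    case (1 y0 t w' j' x')
    have xy: "x' = x + s * q" "y = y0 + t * q" using A(1) 1(1) by auto
    have v: "v = (x + off w, y - j * p + lam)" "v' = (x' - j' * p + lam, y0 + off w')" using A 1 by auto
    have Y: "y - t * c * p + lam = y0 + off t" and X: "x' - s * c * p + lam = x + off s"
      unfolding xy off_def q by (simp_all add: algebra_simps)
    have "conn r p (board (C + r) (D + r)) (x + off w, y - j * p + lam) (x + off s, y - (t * c) * p + lam)"
      by (rule tag_y_conn[OF A(3-9) A(5)])
        (use 1 c off_bounds[of t] in \<open>auto simp: Y\<close>)
    moreover have "conn r p (board (C + r) (D + r)) (x' - j' * p + lam, y0 + off w') (x' - (s * c) * p + lam, y0 + off t)"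
      by (rule tag_x_conn[OF 1(3-9) 1(5)])
        (use A c off_bounds[of s] in \<open>auto simp: X\<close>)
    ultimately show ?thesis unfolding v X Y using conn_sym conn_trans by meson
  qed
qed

text \<open>\<open>C \<le> q\<close> makes the two row intervals disjoint, so the row determines its
  bit. Columns can be ambiguous and need a separate argument.\<close>

lemma tag_x_tag_x_conn:
  assumes "tag_x u v" "tag_x u v'" "C \<le> q"
  shows "conn r p (board (C + r) (D + r)) v v'"
  using assms(1)
proof (cases rule: tag_x.cases)
  case (1 y s w j x)
  note A = 1
  from assms(2) show ?thesis
  proof (cases rule: tag_x.cases)
    case (1 y' s' w' j' x')
    have "x' = x" "y' + s' * q = y + s * q" using A(1) 1(1) by auto
    moreover from this have "s' = s" using A(3-5) 1(3-5) assms(3) by auto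
    ultimately have e: "x' = x" "s' = s" "y' = y" by auto
    show ?thesis unfolding A(2) 1(2) e
      by (rule tag_x_conn[OF A(3-9)]) (use 1(6-9) in \<open>simp_all add: e\<close>)
  qed
qed

end

text \<open>\<open>p - r < C\<close> gives the tail board more than p rows, so it contains every
  residue modulo p together with the next row. \<open>C < p\<close> keeps the row intervals apart,
  and the bound on D leaves a single case in which column intervals overlap.\<close>

locale separator_step = tail_step +
  fixes F :: "cell \<Rightarrow> int \<times> int" and B :: int
  assumes sep: "separator r p (C + r) (D + r) F B"
    and C: "p - r < C" "C < p" and D: "p \<le> D" "D < 2 * p - 1" and CD_overlap: "q < D \<Longrightarrow> r \<le> C"
begin

lemma F_conn: "conn r p (board (C + r) (D + r)) u v \<Longrightarrow> F u = F v"
  using separator_conn[OF sep] .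

text \<open>
A column can belong to both intervals [0, D) and [q, q + D) only for c = 2 with negative remainder; its
two tail positions then have to be compared.
\<close>

lemma overlap:
  assumes "q < D"
  shows "c = 2" "lam = r" "mu = 0" "q = 2 * p - r" "r \<le> C" "2 * p < D + r"
proof -
  have "c < 4"
  proof (rule ccontr)
    assume "\<not> c < 4"
    then have "4 * p \<le> c * p" using pos by (intro mult_right_mono) auto
    then show False using assms D r lm q by linarith
  qed
  then show c2: "c = 2" using c by presburger
  show "lam = r" "mu = 0" using lm q c2 assms D r by auto
  then show "q = 2 * p - r" using q c2 by simp
  with assms show "2 * p < D + r" by simp
  show "r \<le> C" using CD_overlap assms by simp
qed

text \<open>After an even number of steps the two tail columns differ by 2 p and two tail moves join
  them. After an odd number they differ by 2 (p - r), which is the shift in the third clause of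
  \<open>separator\<close>.\<close>

lemma tag_y_overlap:
  assumes "q < x + 1" "x < D" "w = 0 \<or> w = 1" "even (w + j)" "0 \<le> y - j * p + lam" "y - j * p + lam < C + r"
    and "w' = 0 \<or> w' = 1" "even (1 + w' + j')" "0 \<le> y - j' * p + lam" "y - j' * p + lam < C + r"
  shows "F (x + off w, y - j * p + lam) = F (x - q + off w', y - j' * p + lam)"
proof -
  have qD: "q < D" using assms by simp
  note o = overlap[OF qD]
  have off: "off 0 = r" "off 1 = 0" using off_simps o by simp_all
  have x: "0 \<le> x" "0 \<le> x - q" "x - q < D" using assms pos by auto
  show ?thesis
  proof (cases "\<exists>i. even i \<and> 0 \<le> y - i * p + lam \<and> y - i * p + lam < C + r")
    case True
    then obtain i where i: "even i" "0 \<le> y - i * p + lam" "y - i * p + lam < C + r" by blast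
    define Y where "Y = y - i * p + lam"
    have 1: "F (x + off w, y - j * p + lam) = F (x + off 0, Y)" unfolding Y_def
      by (rule F_conn, rule tag_y_conn[where s = 0]) (use assms i x in auto)
    have 2: "F (x - q + off w', y - j' * p + lam) = F (x - q + off 1, Y)" unfolding Y_def
      by (rule F_conn, rule tag_y_conn[OF x(2,3) disjI2[OF refl] assms(7-10)]) (use i in simp_all)
    obtain y1 t where y1: "0 \<le> y1" "y1 < C" "Y = y1 + off t" "t = 0 \<or> t = 1"
    proof (cases "Y < C")
      case True
      then show ?thesis using that[of Y 1] i off by (auto simp: Y_def)
    next
      case False
      then show ?thesis using that[of "Y - r" 0] i off o by (auto simp: Y_def)
    qed
    have "conn r p (board (C + r) (D + r)) (x + r, y1 + off t) (x - q, y1 + off t)"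
      by (rule tail_sweep_x[OF y1(1,2) _ _ _ _ _ _ y1(4) y1(4), where j = "- 2"]; (simp; fail)?)
        (use x assms(1,2) o r in linarith)+
    then have "F (x + off 0, Y) = F (x - q + off 1, Y)"
      unfolding y1(3) off by (intro F_conn) simp
    then show ?thesis using 1 2 by simp
  next
    case False
    then have j: "odd j" "odd j'" using assms(5,6,9,10) by blast+
    have w: "w = 1" "w' = 0" using assms(3,4,7,8) j by auto
    define Y where "Y = y - j * p + lam"
    have no: "\<not> (0 \<le> y - i * p + lam \<and> y - i * p + lam < C + r)" if "even i" for i
      using False that by blast
    \<comment> \<open>No even number of steps reaches the tail board, so no vertical step of p is
      possible from row Y. This is exactly the range of rows in the third clause.\<close>
    have "\<not> (0 \<le> Y - p \<and> Y - p < C + r)" "\<not> (0 \<le> Y + p \<and> Y + p < C + r)"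
      using no[of "j + 1"] no[of "j - 1"] j(1) by (simp_all add: Y_def algebra_simps)
    moreover have "0 \<le> Y" "Y < C + r" using assms(5,6) by (simp_all add: Y_def)
    ultimately have Y: "0 \<le> Y" "Y < p" "C + r - p \<le> Y" using pos by linarith+
    have 2: "F (x - q + off w', y - j' * p + lam) = F (x - q + off 0, y - j * p + lam)"
      by (rule F_conn, rule tag_y_conn[OF x(2,3) disjI2[OF refl] assms(7-10)])
         (use j assms(5,6) in simp_all)
    have "F (x - q + r, Y) = F (x - q + r + 2 * (p - r), Y)"
      by (rule separator_shift[OF sep]) (use Y x o assms(1,2) qD in linarith)+
    moreover have "x - q + r + 2 * (p - r) = x" using o(4) by simp
    ultimately have "F (x - q + r, Y) = F (x, Y)" by metis
    then show ?thesis using 2 w off by (simp add: Y_def)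
  qed
qed

lemma tag_y_tag_y:
  assumes "tag_y u v" "tag_y u v'"
  shows "F v = F v'"
  using assms(1)
proof (cases rule: tag_y.cases)
  case (1 x s w j y)
  note A = 1
  from assms(2) show ?thesis
  proof (cases rule: tag_y.cases)
    case (1 x' s' w' j' y')
    have e: "y' = y" "x' + s' * q = x + s * q" using A(1) 1(1) by auto
    consider "s' = s" | "s = 0" "s' = 1" | "s = 1" "s' = 0" using A(5) 1(5) by auto
    then show ?thesis
    proof cases
      case 1
      then have "x' = x" using e by simp
      show ?thesis unfolding A(2) \<open>v' = _\<close> e \<open>x' = x\<close>
        by (rule F_conn, rule tag_y_conn[OF A(3-9)]) (use \<open>s' = s\<close> \<open>w' = 0 \<or> w' = 1\<close> \<open>even (s' + w' + j')\<close>
          \<open>0 \<le> y' - j' * p + lam\<close> \<open>y' - j' * p + lam < C + r\<close> e in simp_all)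
    next
      case 2
      then have x': "x' = x - q" using e by simp
      show ?thesis unfolding A(2) \<open>v' = _\<close> e(1) x'
        by (rule tag_y_overlap) (use A(3-9) \<open>w' = 0 \<or> w' = 1\<close> \<open>even (s' + w' + j')\<close>
          \<open>0 \<le> y' - j' * p + lam\<close> \<open>y' - j' * p + lam < C + r\<close> \<open>0 \<le> x'\<close> 2 e x' in simp_all)
    next
      case 3
      then have x': "x = x' - q" using e by simp
      show ?thesis unfolding A(2) \<open>v' = _\<close> e(1) x'
        by (rule tag_y_overlap[symmetric]) (use A(3-9) \<open>w' = 0 \<or> w' = 1\<close> \<open>even (s' + w' + j')\<close>
          \<open>0 \<le> y' - j' * p + lam\<close> \<open>y' - j' * p + lam < C + r\<close> \<open>x' < D\<close> 3 e x' in simp_all)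
    qed
  qed
qed

definition tag :: "cell \<Rightarrow> cell \<Rightarrow> bool" where
  "tag u v \<longleftrightarrow> tag_x u v \<or> tag_y u v"

lemma tag_unique:
  assumes "tag u v" "tag u v'"
  shows "F v = F v'"
proof -
  have "C \<le> q" using C p_less_q by simp
  then show ?thesis
    using assms tag_y_tag_y[of u v v'] tag_x_tag_x_conn[of u v v', THEN F_conn]
      tag_y_tag_x_conn[of u v v', THEN F_conn] tag_y_tag_x_conn[of u v' v, THEN F_conn]
    unfolding tag_def by auto
qed

text \<open>No move touches an untagged cell. Its value starts with B, which F never attains, so it
  differs from all tagged cells; the row number separates two untagged neighbours.\<close>

definition G :: "cell \<Rightarrow> int \<times> int" where
  "G u = (if \<exists>v. tag u v then F (SOME v. tag u v) else (B, snd u))"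

lemma G_tag: "tag u v \<Longrightarrow> G u = F v"
  unfolding G_def using tag_unique by (metis someI)

lemma tag_yI:
  assumes "0 \<le> x" "x < D" "s = 0 \<or> s = 1" "even (s + w + j)" "w = 0 \<or> w = 1"
    and "Y = y - j * p + lam" "0 \<le> Y" "Y < C + r"
  shows "tag (x + s * q, y) (x + off w, Y)"
  unfolding tag_def using tag_y.intros[of x s w j y] assms by blast

lemma tag_xI:
  assumes "0 \<le> y" "y < C" "s = 0 \<or> s = 1" "even (s + w + j)" "w = 0 \<or> w = 1"
    and "X = x - j * p + lam" "0 \<le> X" "X < D + r"
  shows "tag (x, y + s * q) (X, y + off w)"
  unfolding tag_def using tag_x.intros[of y s w j x] assms by blast

lemma bit_parity: obtains w :: int where "w = 0 \<or> w = 1" "even (k + w + j)"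
  using that[of 0] that[of 1] by auto

lemma residue: obtains j Y where "Y = y - j * p + lam" "0 \<le> Y" "Y < p"
proof (rule that)
  show "(y + lam) mod p = y - (y + lam) div p * p + lam"
    using div_mult_mod_eq[of "y + lam" p] by linarith
qed (use pos in simp_all)

text \<open>Both ends have a common tag: the extra step changes j by k and the bit s to 1 - s, which
  leaves the parity condition intact.\<close>

lemma G_step_y:
  assumes "0 \<le> x" "x < D" "s = 0 \<or> s = 1" "k = 1 \<or> k = -1"
  shows "G (x + s * q, y) = G (x + (1 - s) * q, y + k * p)"
proof -
  obtain j Y where Y: "Y = y - j * p + lam" "0 \<le> Y" "Y < p" by (rule residue)
  obtain w where w: "w = 0 \<or> w = 1" "even (s + w + j)" by (rule bit_parity)
  have "tag (x + s * q, y) (x + off w, Y)"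
    by (rule tag_yI[OF assms(1,2,3) w(2,1) Y(1,2)]) (use Y C in linarith)
  moreover have "tag (x + (1 - s) * q, y + k * p) (x + off w, Y)"
  proof (rule tag_yI[OF assms(1,2) _ _ w(1) _ Y(2)])
    show "even (1 - s + w + (j + k))" using w(2) assms(4) by auto
    show "Y = y + k * p - (j + k) * p + lam" using Y(1) by (simp add: algebra_simps)
  qed (use assms(3) Y(3) C in auto)
  ultimately show ?thesis using G_tag by simp
qed

lemma G_step_x:
  assumes "0 \<le> y" "y < C" "s = 0 \<or> s = 1" "k = 1 \<or> k = -1"
  shows "G (x, y + s * q) = G (x + k * p, y + (1 - s) * q)"
proof -
  obtain j Y where Y: "Y = x - j * p + lam" "0 \<le> Y" "Y < p" by (rule residue)
  obtain w where w: "w = 0 \<or> w = 1" "even (s + w + j)" by (rule bit_parity)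
  have "tag (x, y + s * q) (Y, y + off w)"
    by (rule tag_xI[OF assms(1,2,3) w(2,1) Y(1,2)]) (use Y D r in linarith)
  moreover have "tag (x + k * p, y + (1 - s) * q) (Y, y + off w)"
  proof (rule tag_xI[OF assms(1,2) _ _ w(1) _ Y(2)])
    show "even (1 - s + w + (j + k))" using w(2) assms(4) by auto
    show "Y = x + k * p - (j + k) * p + lam" using Y(1) by (simp add: algebra_simps)
  qed (use assms(3) Y(3) D r in auto)
  ultimately show ?thesis using G_tag by simp
qed

lemma G_hop:
  assumes "hop p q (board (C + q) (D + q)) u v"
  shows "G u = G v"
proof -
  obtain x y x' y' where T: "u = (x, y)" "v = (x', y')" by (metis surj_pair)
  have b: "0 \<le> x" "x < D + q" "0 \<le> y" "y < C + q" "0 \<le> x'" "x' < D + q" "0 \<le> y'" "y' < C + q"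
    and adj: "(\<bar>x - x'\<bar> = p \<and> \<bar>y - y'\<bar> = q) \<or> (\<bar>x - x'\<bar> = q \<and> \<bar>y - y'\<bar> = p)"
    using assms by (auto simp: hop_def T leaper_adj_iff)
  from adj show ?thesis
  proof
    assume *: "\<bar>x - x'\<bar> = p \<and> \<bar>y - y'\<bar> = q"
    have "x' = x + 1 * p \<or> x' = x + (- 1) * p" using * by linarith
    then obtain k where k: "x' = x + k * p" "k = 1 \<or> k = -1" by blast
    show ?thesis
    proof (cases "y' \<ge> y")
      case True
      then show ?thesis using G_step_x[of y 0 k x] k * b T by auto
    next
      case False
      then show ?thesis using G_step_x[of y' 1 k x] k * b T by auto
    qed
  next
    assume *: "\<bar>x - x'\<bar> = q \<and> \<bar>y - y'\<bar> = p"
    have "y' = y + 1 * p \<or> y' = y + (- 1) * p" using * by linarith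
    then obtain k where k: "y' = y + k * p" "k = 1 \<or> k = -1" by blast
    show ?thesis
    proof (cases "x' \<ge> x")
      case True
      then show ?thesis using G_step_y[of x 0 k y] k * b T by auto
    next
      case False
      then show ?thesis using G_step_y[of x' 1 k y] k * b T by auto
    qed
  qed
qed

lemma tail_board_of_tag: "tag u v \<Longrightarrow> v \<in> board (C + r) (D + r)"
  unfolding tag_def
proof (elim disjE)
  assume "tag_x u v"
  then show ?thesis by cases (use off_bounds in fastforce)
next
  assume "tag_y u v"
  then show ?thesis by cases (use off_bounds in fastforce)
qed

text \<open>The same j and w serve both cells, so the tags are vertical neighbours. Row Y + 1 may
  equal p, which is still on the tail board because \<open>p - r < C\<close>.\<close>

lemma G_vertical_y:
  assumes "0 \<le> x" "x < D" "s = 0 \<or> s = 1"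
  shows "G (x + s * q, y) \<noteq> G (x + s * q, y + 1)"
proof -
  obtain j Y where Y: "Y = y - j * p + lam" "0 \<le> Y" "Y < p" by (rule residue)
  obtain w where w: "w = 0 \<or> w = 1" "even (s + w + j)" by (rule bit_parity)
  have t: "tag (x + s * q, y) (x + off w, Y)"
    by (rule tag_yI[OF assms(1,2,3) w(2,1) Y(1,2)]) (use Y C in linarith)
  have t': "tag (x + s * q, y + 1) (x + off w, Y + 1)"
    by (rule tag_yI[OF assms(1,2,3) w(2,1)]) (use Y C in linarith)+
  have "F (x + off w, Y) \<noteq> F (x + off w, Y + 1)"
    using sep tail_board_of_tag[OF t] tail_board_of_tag[OF t'] unfolding separator_def by blast
  then show ?thesis using G_tag[OF t] G_tag[OF t'] by simp
qed

lemma G_vertical_x: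
  assumes "0 \<le> y" "y + 1 < C" "s = 0 \<or> s = 1"
  shows "G (x, y + s * q) \<noteq> G (x, y + s * q + 1)"
proof -
  obtain j Y where Y: "Y = x - j * p + lam" "0 \<le> Y" "Y < p" by (rule residue)
  obtain w where w: "w = 0 \<or> w = 1" "even (s + w + j)" by (rule bit_parity)
  have t: "tag (x, y + s * q) (Y, y + off w)"
    by (rule tag_xI[OF assms(1) _ assms(3) w(2,1) Y(1,2)]) (use assms Y D r in linarith)+
  have t': "tag (x, (y + 1) + s * q) (Y, (y + 1) + off w)"
    by (rule tag_xI[OF _ _ assms(3) w(2,1) Y(1,2)]) (use assms Y D r in linarith)+
  have "F (Y, y + off w) \<noteq> F (Y, y + off w + 1)"
  proof -
    have "y + 1 + off w = y + off w + 1" by simp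
    then show ?thesis
      using sep tail_board_of_tag[OF t] tail_board_of_tag[OF t'] unfolding separator_def by simp
  qed
  then show ?thesis using G_tag[OF t] G_tag[OF t'] by (simp add: algebra_simps)
qed

lemma fst_F: "tag u v \<Longrightarrow> fst (F v) < B"
  using tail_board_of_tag sep unfolding separator_def by blast

lemma G_vertical: "G (x, y) \<noteq> G (x, y + 1)"
proof -
  consider v where "tag_y (x, y) v" | v where "tag_y (x, y + 1) v"
    | v v' where "tag_x (x, y) v" "tag_x (x, y + 1) v'"
    | v where "tag (x, y) v" "\<nexists>v. tag (x, y + 1) v" | v where "tag (x, y + 1) v" "\<nexists>v. tag (x, y) v"
    | "\<nexists>v. tag (x, y) v" "\<nexists>v. tag (x, y + 1) v"
    unfolding tag_def by blast
  then show ?thesis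
  proof cases
    case 1
    then show ?thesis by cases (use G_vertical_y in auto)
  next
    case 2
    then show ?thesis by cases (use G_vertical_y in auto)
  next
    case 3
    obtain y0 s where y0: "0 \<le> y0" "y0 < C" "s = 0 \<or> s = 1" "y = y0 + s * q"
      using 3(1) by cases auto
    obtain y1 t where y1: "0 \<le> y1" "y1 < C" "t = 0 \<or> t = 1" "y + 1 = y1 + t * q"
      using 3(2) by cases auto
    have "s = t" using y0 y1 C p_less_q by auto
    then show ?thesis using G_vertical_x[of y0 s x] y0 y1 by auto
  next
    case 4
    then have "G (x, y + 1) = (B, y + 1)" by (simp add: G_def)
    then show ?thesis using G_tag[OF 4(1)] fst_F[OF 4(1)] by (metis fst_conv less_irrefl)
  next
    case 5
    then have "G (x, y) = (B, y)" by (simp add: G_def)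
    then show ?thesis using G_tag[OF 5(1)] fst_F[OF 5(1)] by (metis fst_conv less_irrefl)
  next
    case 6
    then show ?thesis by (simp add: G_def)
  qed
qed

text \<open>On the larger board the shift is realised by a walk of four moves. The sign k selects
  whether it first goes up or down; \<open>p - r < C\<close> and \<open>r \<le> C\<close> ensure
  that one of the two fits.\<close>

lemma G_overlap:
  assumes "2 * q < D + q" "p \<le> x" "x < D + q - 2 * q + p" "C + q - q \<le> y" "y < q"
  shows "G (x, y) = G (x + 2 * (q - p), y)"
proof -
  have o: "c = 2" "lam = r" "mu = 0" "q = 2 * p - r" "r \<le> C" "2 * p < D + r" using overlap assms(1) by auto
  obtain k :: int where k: "k = 1 \<or> k = -1" and yk: "0 \<le> y + k * p" "y + k * p < C + q"
    "0 \<le> y + k * p - k * q" "y + k * p - k * q < C + q"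
  proof (cases "p \<le> y")
    case True
    then show ?thesis using that[of "-1"] assms o C pos r p_less_q by simp
  next
    case False
    then show ?thesis using that[of 1] assms o C pos r p_less_q by simp
  qed
  have x: "x + q < D + q" "0 \<le> x + q - 2 * p" "x + 2 * (q - p) < D + q" "0 \<le> x" "p < q"
    using assms(1-3) pos p_less_q o(4) r by auto
  have kq: "y + k * p - k * q = y + k * p + q \<or> y + k * p - k * q = y + k * p - q"
    "y + k * p = y + k * p - k * q + q \<or> y + k * p = y + k * p - k * q - q"
    "y + k * p = y + p \<or> y + k * p = y - p" "y = y + k * p + p \<or> y = y + k * p - p" using k by auto
  have y: "0 \<le> y" "y < C + q" using assms(4,5) CD by auto
  have "G (x, y) = G (x + q, y + k * p)"
    by (intro G_hop hop_qpI pos kq) (use x y yk pos in auto)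
  also have "\<dots> = G (x + q - p, y + k * p - k * q)"
    by (intro G_hop hop_pqI pos kq) (use x y yk pos in auto)
  also have "\<dots> = G (x + q - 2 * p, y + k * p)"
    by (intro G_hop hop_pqI pos kq) (use x y yk pos in auto)
  also have "\<dots> = G (x + 2 * (q - p), y)"
    by (intro G_hop hop_qpI pos kq) (use x y yk pos in auto)
  finally show ?thesis .
qed

lemma separator_G: "separator p q (C + q) (D + q) G (B + 1)"
  unfolding separator_def
proof (intro conjI allI impI ballI)
  fix u assume "u \<in> board (C + q) (D + q)"
  show "fst (G u) < B + 1"
  proof (cases "\<exists>v. tag u v")
    case True
    then show ?thesis using G_tag fst_F by fastforce
  qed (simp add: G_def)
qed (use G_hop G_vertical G_overlap in auto)

end


section \<open>Separating functions for two and three partial quotients\<close>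

text \<open>
J marks the rows at odd distance from a corner row; g is the separating function on the other rows.
\<close>

lemma base_separator:
  fixes J :: "int \<Rightarrow> bool" and g :: "int \<Rightarrow> int \<Rightarrow> int \<times> int"
  assumes pq: "0 < p" "p < q"
    and J_p: "\<And>y. J (y + p) \<longleftrightarrow> \<not> J y"
    and J_q: "\<And>y. 0 \<le> y \<Longrightarrow> y + q < m \<Longrightarrow> \<not> J y \<and> \<not> J (y + q)"
    and g_p: "\<And>x y. g x (y + p) = g x y"
    and g_pq: "\<And>x y. 0 \<le> y \<Longrightarrow> y + q < m \<Longrightarrow> g (x + p) (y + q) = g x y \<and> g (x + p) y = g x (y + q)"
    and g_q: "\<And>x y. 0 \<le> x \<Longrightarrow> x + 2 * q < n \<Longrightarrow> g (x + 2 * q) y = g x y"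
    and g_Suc: "\<And>x y. J (y + 1) = J y \<Longrightarrow> g x (y + 1) \<noteq> g x y"
    and g_Suc_q: "\<And>x y. J (y + 1) \<noteq> J y \<Longrightarrow> g (x + q) (y + 1) \<noteq> g x y \<and> g x (y + 1) \<noteq> g (x + q) y"
    and g_shift: "\<And>x y. p \<le> x \<Longrightarrow> x < n - 2 * q + p \<Longrightarrow>
      g (x + 2 * (q - p)) y = g x y \<and> g (x + q - 2 * p) y = g (x + q) y"
    and bound: "\<And>x y. fst (g x y) < B"
  shows "\<exists>F. separator p q m n F B"
proof -
  \<comment> \<open>An odd row takes the value of a neighbour q columns and p rows away: by
    \<open>g_q\<close> left and right agree, by \<open>g_p\<close> up and down do.\<close>
  define F where "F = (\<lambda>(x, y). if J y then g (if q \<le> x then x - q else x + q) y else g x y)"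
  have F_odd: "F (x', y') = g x y" if "\<bar>x - x'\<bar> = q" "J y'" "\<bar>y - y'\<bar> = p"
    "0 \<le> x" "x < n" "0 \<le> x'" "x' < n" for x y x' y'
  proof -
    have gy: "g z y' = g z y" for z
      using g_p[of z y] g_p[of z y'] that(3) by (smt (verit) abs_diff_less_iff)
    show ?thesis
    proof (cases "q \<le> x'")
      case True
      then have "x = x' - q \<or> x = x' - q + 2 * q" using that by linarith
      then have "g (x' - q) y = g x y"
        using g_q[of "x' - q" y] True that by auto
      then show ?thesis using that True gy by (simp add: F_def)
    next
      case False
      then have "x = x' + q" using that by linarith
      then show ?thesis using that False gy by (simp add: F_def)
    qed
  qed
  have hop: "F u = F v" if "hop p q (board m n) u v" for u v
  proof -
    obtain x y x' y' where T: "u = (x, y)" "v = (x', y')" by (metis surj_pair)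
    have b: "0 \<le> x" "x < n" "0 \<le> y" "y < m" "0 \<le> x'" "x' < n" "0 \<le> y'" "y' < m"
      and adj: "(\<bar>x - x'\<bar> = p \<and> \<bar>y - y'\<bar> = q) \<or> (\<bar>x - x'\<bar> = q \<and> \<bar>y - y'\<bar> = p)"
      using that by (auto simp: hop_def T leaper_adj_iff)
    from adj show ?thesis
    proof
      assume *: "\<bar>x - x'\<bar> = p \<and> \<bar>y - y'\<bar> = q"
      have J: "\<not> J y" "\<not> J y'" using J_q[of y] J_q[of y'] * b by (smt (verit))+
      consider "x' = x + p" "y' = y + q" | "x = x' + p" "y' = y + q"
        | "x' = x + p" "y = y' + q" | "x = x' + p" "y = y' + q" using * by linarith
      then have "g x y = g x' y'"
        by cases (use g_pq[of y] g_pq[of y'] b in metis)+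
      then show ?thesis using J T by (simp add: F_def)
    next
      assume *: "\<bar>x - x'\<bar> = q \<and> \<bar>y - y'\<bar> = p"
      then have "y' = y + p \<or> y = y' + p" by linarith
      then have J: "J y' \<longleftrightarrow> \<not> J y" using J_p by metis
      show ?thesis
      proof (cases "J y")
        case True
        then show ?thesis using F_odd[of x' x y y'] * b J T by (simp add: F_def abs_minus_commute)
      next
        case False
        then show ?thesis using F_odd[of x x' y' y] * b J T by (simp add: F_def)
      qed
    qed
  qed
  have Suc: "F (x, y) \<noteq> F (x, y + 1)" for x y
  proof -
    have "g z y \<noteq> g z (y + 1)" if "J (y + 1) = J y" for z using g_Suc[OF that, of z] by metis
    then show ?thesis using g_Suc_q[of y "x"] g_Suc_q[of y "x - q"] by (auto simp: F_def)
  qed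
  have shift: "F (x, y) = F (x + 2 * (q - p), y)"
    if "p \<le> x" "x < n - 2 * q + p" for x y
  proof (cases "J y")
    case True
    have "q \<le> x + 2 * (q - p)" using that pq by (simp add: algebra_simps)
    then have "F (x + 2 * (q - p), y) = g (x + 2 * (q - p) - q) y"
      using True unfolding F_def by simp
    moreover have "x + 2 * (q - p) - q = x + q - 2 * p" by simp
    ultimately have 1: "F (x + 2 * (q - p), y) = g (x + q) y"
      using g_shift[OF that, of y] by metis
    show ?thesis
    proof (cases "q \<le> x")
      case x: True
      then have "g (x - q + 2 * q) y = g (x - q) y" using that pq by (intro g_q) auto
      then show ?thesis unfolding 1 using True x by (simp add: F_def add.commute)
    next
      case False
      then show ?thesis unfolding 1 using True by (simp add: F_def)
    qed
  next
    case False
    then show ?thesis using g_shift[OF that, of y] by (simp add: F_def)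
  qed
  have "fst (F u) < B" for u
    using bound by (cases u) (simp add: F_def)
  then have "separator p q m n F B"
    unfolding separator_def using hop Suc shift by blast
  then show ?thesis by blast
qed

text \<open>As q is odd and p even, a move by p columns and q rows changes both the column block and
  the row parity, and keeps the column parity. The latter changes between x and x + q, as needed
  between even and odd rows.\<close>

lemma base_separator_two:
  fixes p q c \<epsilon> :: int
  assumes p: "even p" "2 \<le> p" and c: "even c" "2 \<le> c" and q: "q = c * p + \<epsilon>" and \<epsilon>: "\<epsilon> = 1 \<or> \<epsilon> = -1"
  shows "\<exists>F. separator p q (p + q - 1) (p + 2 * q - 2) F 2"
proof -
  \<comment> \<open>A jump by 2 q changes the residue modulo p by 2 \<epsilon>. This offset keeps
    the residues of the p - 2 columns that admit such a jump within one block.\<close>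
  define dl where "dl = 1 - \<epsilon>"
  \<comment> \<open>Aligns the blocks of p rows so that both bands of p - 1 corner rows lie in even
    blocks.\<close>
  define os where "os = (if \<epsilon> = 1 then 0 else 1 :: int)"
  have q_odd: "odd q" using p q \<epsilon> by auto
  have "2 * p \<le> c * p" using c p by (intro mult_right_mono) auto
  then have pq: "p < q" using p \<epsilon> unfolding q by linarith
  have div0: "(x + k * p) div p = k" if "0 \<le> x" "x < p" for x k
    using that by simp
  have cell: "(x + 2 * q + dl) div p = 2 * c \<and> (x + dl) div p = 0" if "0 \<le> x" "x < p - 2" for x
  proof -
    have e: "x + 2 * q + dl = (x + dl + 2 * \<epsilon>) + (2 * c) * p" unfolding q by (simp add: algebra_simps)
    have "0 \<le> x + dl + 2 * \<epsilon>" "x + dl + 2 * \<epsilon> < p" "0 \<le> x + dl" "x + dl < p"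
      using that \<epsilon> by (auto simp: dl_def)
    then show ?thesis unfolding e using div0[of "x + dl + 2 * \<epsilon>" "2 * c"] div0[of "x + dl" 0] by simp
  qed
  show ?thesis
  proof (rule base_separator[where J = "\<lambda>y. odd ((y + os) div p)"
      and g = "\<lambda>x y. (((x + dl) div p + y) mod 2, x mod 2)"])
    fix x y :: int
    show "0 < p" "p < q" using p pq by auto
    have e: "y + p + os = (y + os) + 1 * p" by simp
    show "odd ((y + p + os) div p) \<longleftrightarrow> \<not> odd ((y + os) div p)" unfolding e using p by simp
    show "(((x + dl) div p + (y + p)) mod 2, x mod 2) = (((x + dl) div p + y) mod 2, x mod 2)"
      using p by (simp add: mod2_eq_if)
    show "fst (((x + dl) div p + y) mod 2, x mod 2) < 2" by simp
  next
    fix y assume y: "0 \<le> y" "y + q < p + q - 1"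
    have e: "y + q + os = (y + \<epsilon> + os) + c * p" unfolding q by simp
    have "0 \<le> y + \<epsilon> + os" "y + \<epsilon> + os < p" "0 \<le> y + os" "y + os < p"
      using y \<epsilon> by (auto simp: os_def)
    then show "\<not> odd ((y + os) div p) \<and> \<not> odd ((y + q + os) div p)"
      unfolding e using div0[of "y + \<epsilon> + os" c] c by simp
  next
    fix x y :: int
    have e: "x + p + dl = (x + dl) + 1 * p" by simp
    have "(k + 1 + (y + q)) mod 2 = (k + y) mod 2 \<and> (k + 1 + y) mod 2 = (k + (y + q)) mod 2 \<and>
      (x + p) mod 2 = x mod 2" for k :: int
      using q_odd p(1) by (auto simp: mod2_eq_if)
    then show "(((x + p + dl) div p + (y + q)) mod 2, (x + p) mod 2) = (((x + dl) div p + y) mod 2, x mod 2) \<and>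
      (((x + p + dl) div p + y) mod 2, (x + p) mod 2) = (((x + dl) div p + (y + q)) mod 2, x mod 2)"
      unfolding e using p by simp
  next
    fix x y assume "0 \<le> x" "x + 2 * q < p + 2 * q - 2"
    then show "(((x + 2 * q + dl) div p + y) mod 2, (x + 2 * q) mod 2) = (((x + dl) div p + y) mod 2, x mod 2)"
      using cell[of x] by (simp add: mod2_eq_if)
  next
    fix x y :: int
    show "(((x + dl) div p + (y + 1)) mod 2, x mod 2) \<noteq> (((x + dl) div p + y) mod 2, x mod 2)"
      by (simp add: mod2_eq_if)
  next
    fix x y :: int
    have "(x + q) mod 2 \<noteq> x mod 2" using q_odd by presburger
    then show "(((x + q + dl) div p + (y + 1)) mod 2, (x + q) mod 2) \<noteq> (((x + dl) div p + y) mod 2, x mod 2) \<and>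
      (((x + dl) div p + (y + 1)) mod 2, x mod 2) \<noteq> (((x + q + dl) div p + y) mod 2, (x + q) mod 2)"
      by auto
  next
    fix x y :: int assume x: "p \<le> x" "x < p + 2 * q - 2 - 2 * q + p"
    have e: "x + 2 * (q - p) + dl = (x - p + 2 * q + dl) + (- 1) * p" "x + dl = (x - p + dl) + 1 * p"
      "x + q + dl = (x + q - 2 * p + dl) + 2 * p" by simp_all
    have sh: "(X + k * p) div p = X div p + k" for X k using p by simp
    have "(x + 2 * (q - p) + dl) div p = 2 * c - 1" "(x + dl) div p = 1"
      "(x + q + dl) div p = (x + q - 2 * p + dl) div p + 2"
      using sh[of "x - p + 2 * q + dl" "- 1", folded e(1)] sh[of "x - p + dl" 1, folded e(2)]
        sh[of "x + q - 2 * p + dl" 2, folded e(3)] cell[of "x - p"] x by simp_all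
    then show "(((x + 2 * (q - p) + dl) div p + y) mod 2, (x + 2 * (q - p)) mod 2) =
        (((x + dl) div p + y) mod 2, x mod 2) \<and>
      (((x + q - 2 * p + dl) div p + y) mod 2, (x + q - 2 * p) mod 2) =
        (((x + q + dl) div p + y) mod 2, (x + q) mod 2)"
      by (simp add: mod2_eq_if)
  qed
qed

text \<open>
Adding c permutes the residues modulo the odd number p in one odd cycle, so two colours would not be enough.
\<close>

lemma three_coloring:
  fixes c d p :: int
  assumes c: "even c" "2 \<le> c" and d: "even d" "2 \<le> d" and p: "p = d * c + 1"
  shows "\<exists>h :: int \<Rightarrow> int. (\<forall>z. h (z + p) = h z) \<and>
    (\<forall>z. 0 \<le> z \<and> z < p - c - 2 \<longrightarrow> h (z + 2 * c) = h z) \<and> (\<forall>z. h (z + c) \<noteq> h z \<and> h z < 3)"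
proof -
  define k where "k = d div 2"
  have k: "p = 2 * c * k + 1" "1 \<le> k" using d p by (auto simp: k_def)
  \<comment> \<open>With colours 0 and 1 only, the wrap at p = 2 c k + 1 shifts residues by one and
    creates a single conflict, between residues c - 1 and 0; colour 2 at c - 1 removes it.\<close>
  define f where "f w = (if w mod (2 * c) < c - 1 then 0 else if w mod (2 * c) = c - 1 then 2 else 1 :: int)" for w
  have res: "(w + 2 * c * i) mod (2 * c) = w" if "0 \<le> w" "w < 2 * c" for w i
    using that by simp
  have c2: "2 * c \<le> 2 * c * k" using k(2) c by simp
  define h where "h z = f (z mod p)" for z
  have p0: "0 < p" using c2 k c by linarith
  have f_c: "f (w + c) \<noteq> f w" for w
  proof -
    define \<rho> where "\<rho> = w mod (2 * c)"
    have "0 \<le> \<rho>" "\<rho> < 2 * c" "(w + c) mod (2 * c) = (\<rho> + c) mod (2 * c)"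
      using c by (auto simp: \<rho>_def mod_add_left_eq)
    moreover have "(\<rho> + c) mod (2 * c) = (if \<rho> < c then \<rho> + c else \<rho> - c)"
      using \<open>0 \<le> \<rho>\<close> \<open>\<rho> < 2 * c\<close> res[of "\<rho> + c" 0] res[of "\<rho> - c" 1] by (auto simp: add.commute)
    ultimately show ?thesis unfolding f_def \<rho>_def[symmetric] using c by auto
  qed
  have wrap: "(w + a) mod p = (if w + a < p then w + a else w + a - p)"
    if "0 \<le> w" "w < p" "0 \<le> a" "a \<le> p" for w a
    using that mod_pos_pos_trivial[of "w + a - p" p] mod_add_self2[of "w + a - p" p] by auto
  have hp: "h (z + p) = h z" for z by (simp add: h_def)
  have h2: "h (z + 2 * c) = h z" if z: "0 \<le> z" "z < p - c - 2" for z
  proof (cases "z + 2 * c < p")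
    case True
    then show ?thesis using z c by (simp add: h_def f_def)
  next
    case False
    define i where "i = z + 2 * c - p"
    have i: "0 \<le> i" "i < c - 2" using False z by (auto simp: i_def)
    have ze: "z = i + 1 + 2 * c * (k - 1)" unfolding i_def k(1) by (simp add: algebra_simps)
    have "(z + 2 * c) mod p = i" using wrap[of z "2 * c"] z False c c2 k by (simp add: i_def)
    moreover have "z mod p = z" using z c by simp
    moreover have "z mod (2 * c) = i + 1" "i mod (2 * c) = i"
      unfolding ze using i res[of "i + 1" "k - 1"] by simp_all
    ultimately show ?thesis unfolding h_def f_def using i by simp
  qed
  have hc: "h (z + c) \<noteq> h z" for z
  proof -
    define w where "w = z mod p"
    have w: "0 \<le> w" "w < p" using p0 by (auto simp: w_def)
    have e: "h (z + c) = f ((w + c) mod p)" "h z = f w"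
      by (simp_all add: h_def w_def mod_add_left_eq)
    show ?thesis
    proof (cases "w + c < p")
      case True
      then show ?thesis unfolding e using f_c w c by simp
    next
      case False
      define i where "i = w + c - p"
      have i: "0 \<le> i" "i < c" using False w by (auto simp: i_def)
      have 1: "(w + c) mod p = i" using wrap[of w c] w False c c2 k by (simp add: i_def)
      have we: "w = c + 1 + i + 2 * c * (k - 1)" "w = (i + 1 - c) + 2 * c * k" unfolding i_def k(1) by (simp_all add: algebra_simps)
      have "i mod (2 * c) = i" using i by simp
      moreover have "w mod (2 * c) = (if i = c - 1 then 0 else c + 1 + i)"
      proof (cases "i = c - 1")
        case True
        then have "w = 2 * c * k" using we(2) by simp
        then show ?thesis using True by simp
      next
        case False
        then show ?thesis using res[of "c + 1 + i" "k - 1"] i c unfolding we(1) by simp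
      qed
      ultimately show ?thesis unfolding e 1 f_def using i c by auto
    qed
  qed
  have "h z < 3" for z by (simp add: h_def f_def)
  with hp h2 hc show ?thesis by blast
qed

text \<open>Modulo p a move by q is a shift by \<epsilon> c. Recording rows modulo c inside each
  block of p rows makes corner moves invisible; the colouring of columns distinguishes x from x + q
  but not, where both are on the board, from x + 2 q.\<close>

lemma base_separator_three:
  fixes p q c c' c'' \<epsilon> :: int
  assumes c: "even c" "2 \<le> c" and c': "even c'" "2 \<le> c'" and c'': "even c''" "2 \<le> c''"
    and p: "p = c' * c + 1" and q: "q = c'' * p + \<epsilon> * c" and \<epsilon>: "\<epsilon> = 1 \<or> \<epsilon> = -1"
  shows "\<exists>F. separator p q (p + q - c) (p + 2 * q - c - 2) F 3"
proof -
  obtain H :: "int \<Rightarrow> int" where H: "\<And>z. H (z + p) = H z"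
    "\<And>z. 0 \<le> z \<Longrightarrow> z < p - c - 2 \<Longrightarrow> H (z + 2 * c) = H z" "\<And>z. H (z + c) \<noteq> H z" "\<And>z. H z < 3"
    using three_coloring[OF c c' p] by blast
  have H_per: "H (z + of_nat k * p) = H z" for z k
  proof (induction k)
    case (Suc k)
    have "z + of_nat (Suc k) * p = (z + of_nat k * p) + p" by (simp add: algebra_simps)
    then show ?case using Suc H(1) by metis
  qed simp
  have H_per': "H (z + k * p) = H z" for z k
  proof (cases "k \<ge> 0")
    case True
    then show ?thesis using H_per[of z "nat k"] by simp
  next
    case False
    then show ?thesis using H_per[of "z + k * p" "nat (- k)"] by simp
  qed
  \<comment> \<open>The reflection preserves the interval [0, p - c - 2) and reduces shifts by -c to
    shifts by c.\<close>
  define h where "h x = (if \<epsilon> = 1 then H x else H (p - c - 3 - x))" for x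
  have h_per: "h (x + k * p) = h x" for x k
    using H_per'[of x k] H_per'[of "p - c - 3 - x" "- k"] by (simp add: h_def algebra_simps)
  have h_q: "h (x + 2 * q) = h x" if "0 \<le> x" "x < p - c - 2" for x
  proof (cases "\<epsilon> = 1")
    case True
    have e: "x + 2 * q = (x + 2 * c) + (2 * c'') * p" unfolding q True by (simp add: algebra_simps)
    show ?thesis unfolding h_def e using True H(2)[OF that] H_per' by (simp add: h_def)
  next
    case False
    then have e: "p - c - 3 - (x + 2 * q) = ((p - c - 3 - x) + 2 * c) + (- 2 * c'') * p"
      unfolding q using \<epsilon> by (auto simp: algebra_simps)
    have "H ((p - c - 3 - x) + 2 * c) = H (p - c - 3 - x)"
      by (rule H(2)) (use that in auto)
    then show ?thesis unfolding h_def e using False H_per' by metis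
  qed
  have h_neq: "h (x + q) \<noteq> h x" for x
  proof (cases "\<epsilon> = 1")
    case True
    have e: "x + q = (x + c) + c'' * p" unfolding q True by (simp add: algebra_simps)
    show ?thesis unfolding h_def e using True H(3)[of x] H_per' by (simp add: h_def)
  next
    case False
    then have e: "p - c - 3 - (x + q) = ((p - c - 3 - x) + c) + (- c'') * p"
      unfolding q using \<epsilon> by (auto simp: algebra_simps)
    show ?thesis unfolding h_def e using False H(3)[of "p - c - 3 - x"] H_per' by metis
  qed
  define os where "os = (if \<epsilon> = 1 then 0 else c)"
  have "2 * c \<le> c' * c" using c' c by (intro mult_right_mono) auto
  then have cp: "2 * c < p" using p by simp
  have "2 * p \<le> c'' * p" using c'' cp c by (intro mult_right_mono) auto
  moreover have "\<epsilon> * c = c \<or> \<epsilon> * c = - c" using \<epsilon> by auto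
  ultimately have pq: "p < q" using cp c unfolding q by linarith
  have p0: "0 < p" using cp c by simp
  have div0: "(x + k * p) div p = k \<and> (x + k * p) mod p = x" if "0 \<le> x" "x < p" for x k
    using that by simp
  have corner: "even ((y + os) div p) \<and> even ((y + q + os) div p) \<and>
      (y + q + os) mod p mod c = (y + os) mod p mod c" if y: "0 \<le> y" "y + q < p + q - c" for y
  proof (cases "\<epsilon> = 1")
    case True
    then have e: "y + q + os = (y + c) + c'' * p" "y + os = y + 0 * p" by (simp_all add: q os_def)
    show ?thesis unfolding e using div0[of y 0] div0[of "y + c" c''] y c c'' by simp
  next
    case False
    then have e: "y + q + os = y + c'' * p" "y + os = (y + c) + 0 * p" using \<epsilon> by (auto simp: q os_def)
    show ?thesis unfolding e using div0[of "y + c" 0] div0[of y c''] y c c'' by simp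
  qed
  have row_Suc: "(y + 1 + os) mod p mod c \<noteq> (y + os) mod p mod c"
    if "odd ((y + 1 + os) div p) = odd ((y + os) div p)" for y
  proof -
    define Y where "Y = y + os"
    have Y: "Y = Y mod p + (Y div p) * p" "0 \<le> Y mod p" "Y mod p < p" using p0 by auto
    have "Y mod p \<noteq> p - 1"
    proof
      assume "Y mod p = p - 1"
      moreover have "(Y div p + 1) * p = Y div p * p + p" by (simp add: algebra_simps)
      ultimately have "Y + 1 = 0 + (Y div p + 1) * p" using Y(1) by linarith
      then have "(Y + 1) div p = (0 + (Y div p + 1) * p) div p" by (rule arg_cong)
      also have "\<dots> = Y div p + 1" using div0[of 0 "Y div p + 1"] p0 by blast
      finally show False using that unfolding Y_def by (simp add: algebra_simps)
    qed
    moreover have "Y + 1 = (Y mod p + 1) + (Y div p) * p" using Y(1) by linarith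
    moreover from calculation have "0 \<le> Y mod p + 1" "Y mod p + 1 < p" using Y(2,3) by linarith+
    ultimately have "(Y + 1) mod p = Y mod p + 1" using div0[of "Y mod p + 1" "Y div p"] by metis
    moreover have "(t + 1) mod c \<noteq> t mod c" for t
    proof
      assume "(t + 1) mod c = t mod c"
      then have "c dvd (t + 1) - t" by (simp add: mod_eq_dvd_iff)
      then show False using c zdvd_imp_le[of c 1] by simp
    qed
    moreover have "y + 1 + os = Y + 1" by (simp add: Y_def)
    ultimately show ?thesis by (metis Y_def)
  qed
  show ?thesis
  proof (rule base_separator[where J = "\<lambda>y. odd ((y + os) div p)"
      and g = "\<lambda>x y. (h x, (y + os) mod p mod c)"])
    fix x y :: int
    show "0 < p" "p < q" by fact+
    have e: "y + p + os = (y + os) + 1 * p" by simp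
    show "odd ((y + p + os) div p) \<longleftrightarrow> \<not> odd ((y + os) div p)" unfolding e using p0 by simp
    show "(h x, (y + p + os) mod p mod c) = (h x, (y + os) mod p mod c)" unfolding e by simp
    show "fst (h x, (y + os) mod p mod c) < 3" using H(4) by (simp add: h_def)
  next
    fix y assume "0 \<le> y" "y + q < p + q - c"
    then show "\<not> odd ((y + os) div p) \<and> \<not> odd ((y + q + os) div p)" using corner by simp
  next
    fix x y assume "0 \<le> y" "y + q < p + q - c"
    then show "(h (x + p), (y + q + os) mod p mod c) = (h x, (y + os) mod p mod c) \<and>
        (h (x + p), (y + os) mod p mod c) = (h x, (y + q + os) mod p mod c)"
      using corner h_per[of x 1] by simp
  next
    fix x y assume "0 \<le> x" "x + 2 * q < p + 2 * q - c - 2"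
    then show "(h (x + 2 * q), (y + os) mod p mod c) = (h x, (y + os) mod p mod c)"
      using h_q by simp
  next
    fix x y assume "odd ((y + 1 + os) div p) = odd ((y + os) div p)"
    then show "(h x, (y + 1 + os) mod p mod c) \<noteq> (h x, (y + os) mod p mod c)"
      using row_Suc by simp
  next
    fix x y :: int
    show "(h (x + q), (y + 1 + os) mod p mod c) \<noteq> (h x, (y + os) mod p mod c) \<and>
      (h x, (y + 1 + os) mod p mod c) \<noteq> (h (x + q), (y + os) mod p mod c)"
      using h_neq[of x] by auto
  next
    fix x y :: int assume x: "p \<le> x" "x < p + 2 * q - c - 2 - 2 * q + p"
    have "x + 2 * (q - p) = (x - p + 2 * q) + (- 1) * p" "x = (x - p) + 1 * p"
      "x + q - 2 * p = (x + q) + (- 2) * p" by simp_all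
    then have "h (x + 2 * (q - p)) = h (x - p + 2 * q)" "h x = h (x - p)" "h (x + q - 2 * p) = h (x + q)"
      using h_per[of "x - p + 2 * q" "- 1"] h_per[of "x - p" 1] h_per[of "x + q" "- 2"] by presburger+
    moreover have "h (x - p + 2 * q) = h (x - p)" by (rule h_q) (use x in auto)
    ultimately have "h (x + 2 * (q - p)) = h x" "h (x + q - 2 * p) = h (x + q)" by simp_all
    then show "(h (x + 2 * (q - p)), (y + os) mod p mod c) = (h x, (y + os) mod p mod c) \<and>
      (h (x + q - 2 * p), (y + os) mod p mod c) = (h (x + q), (y + os) mod p mod c)" by simp
  qed
qed


section \<open>The cycle of rows\<close>

locale coprime_leaper =
  fixes p q :: int
  assumes pq: "0 < p" "p < q" and coprime: "coprime p q" and odd_sum: "odd (p + q)"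
begin

lemma cycle_coords_unique:
  assumes "u * p - v * q = u' * p - v' * q" "1 \<le> u" "u \<le> q" "1 \<le> u'" "u' \<le> q"
  shows "u' = u" "v' = v"
proof -
  have e: "(u' - u) * p = (v' - v) * q" using assms(1) by (simp add: algebra_simps)
  then have "q dvd (u' - u) * p" by simp
  then have "q dvd u' - u" using coprime by (simp add: coprime_commute coprime_dvd_mult_left_iff)
  moreover have "\<bar>u' - u\<bar> < q" using assms by linarith
  ultimately show "u' = u" using zdvd_not_zless[of "\<bar>u' - u\<bar>" q] by (cases "u' = u") auto
  then show "v' = v" using e pq by simp
qed

lemma ex_cycle_coords: "\<exists>u v. z = u * p - v * q \<and> 1 \<le> u \<and> u \<le> q"
proof -
  obtain a b where ab: "a * p + b * q = 1" using coprime bezout_int[of p q] by auto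
  define t where "t = (z * a - 1) div q"
  have "0 \<le> (z * a - 1) mod q" "(z * a - 1) mod q < q" using pq by auto
  moreover have "(z * a - 1) mod q = z * a - 1 - t * q"
    unfolding t_def by (simp add: minus_div_mult_eq_mod)
  ultimately have "1 \<le> z * a - t * q" "z * a - t * q \<le> q" by linarith+
  moreover have "z = (z * a - t * q) * p - (- z * b - t * p) * q"
  proof -
    have "z = z * (a * p + b * q)" using ab by simp
    then show ?thesis by (simp add: algebra_simps)
  qed
  ultimately show ?thesis by blast
qed

text \<open>
Starting from the missing row -1 and always moving up by p or down by q, row y is reached after
ups y steps of the first and downs y of the second kind.
\<close>

definition ups :: "int \<Rightarrow> int" where
  "ups y = (SOME u. \<exists>v. y + 1 = u * p - v * q \<and> 1 \<le> u \<and> u \<le> q)"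

definition downs :: "int \<Rightarrow> int" where
  "downs y = (SOME v. y + 1 = ups y * p - v * q)"

lemma coords: "y + 1 = ups y * p - downs y * q" "1 \<le> ups y" "ups y \<le> q"
proof -
  have "\<exists>v. y + 1 = ups y * p - v * q \<and> 1 \<le> ups y \<and> ups y \<le> q"
    unfolding ups_def by (rule someI_ex) (rule ex_cycle_coords)
  then show "1 \<le> ups y" "ups y \<le> q" and "y + 1 = ups y * p - downs y * q"
    unfolding downs_def by (auto intro: someI2)
qed

lemma coords_eqI: "y + 1 = u * p - v * q \<Longrightarrow> 1 \<le> u \<Longrightarrow> u \<le> q \<Longrightarrow> ups y = u \<and> downs y = v"
  using cycle_coords_unique[of u v "ups y" "downs y"] coords by metis

text \<open>\<open>ups\<close> could wrap around only if q divided y + 1. Then y \<ge> q - 1, and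
  the step of p would reach the missing row p + q - 1 or beyond.\<close>

lemma coords_up:
  assumes "0 \<le> y" "y + p < p + q - 1"
  shows "ups (y + p) = ups y + 1" "downs (y + p) = downs y"
proof -
  have "ups y \<noteq> q"
  proof
    assume "ups y = q"
    then have "y + 1 = (p - downs y) * q" using coords(1)[of y] by (simp add: algebra_simps)
    then have "q dvd y + 1" by simp
    then show False using assms zdvd_imp_le[of q "y + 1"] by simp
  qed
  then have "1 \<le> ups y + 1 \<and> ups y + 1 \<le> q" using coords(2,3)[of y] by linarith
  moreover have "y + p + 1 = (ups y + 1) * p - downs y * q" using coords(1)[of y] by (simp add: algebra_simps)
  ultimately show "ups (y + p) = ups y + 1" "downs (y + p) = downs y"
    using coords_eqI[of "y + p"] by blast+
qed

lemma coords_down: "ups (y + q) = ups y" "downs (y + q) = downs y - 1"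
proof -
  have "y + q + 1 = ups y * p - (downs y - 1) * q" using coords(1)[of y] by (simp add: algebra_simps)
  then show "ups (y + q) = ups y" "downs (y + q) = downs y - 1"
    using coords_eqI[of "y + q"] coords(2,3)[of y] by blast+
qed

text \<open>The position on the cycle: y + 1 is congruent to \<open>pos y * p\<close> modulo p +
  q.\<close>

definition pos :: "int \<Rightarrow> int" where
  "pos y = ups y + downs y"

lemma pos_eq: "y + 1 = pos y * p - downs y * (p + q)"
  using coords(1)[of y] by (simp add: pos_def algebra_simps)

lemma pos_bounds:
  assumes "0 \<le> y" "y < p + q - 1"
  shows "1 \<le> pos y" "pos y < p + q"
proof -
  have *: "downs y * q = ups y * p - (y + 1)" using coords(1)[of y] by simp
  have "1 * p \<le> ups y * p" "ups y * p \<le> q * p" using coords(2,3)[of y] pq by (intro mult_right_mono; simp)+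
  then have "- 1 * q < downs y * q" "downs y * q < p * q" using * assms by (simp_all add: algebra_simps)
  then have "0 < (downs y + 1) * q" "downs y * q < p * q" by (simp_all add: algebra_simps)
  then have "- 1 < downs y" "downs y < p" using pq by (simp_all add: zero_less_mult_iff)
  then show "1 \<le> pos y" "pos y < p + q" using coords(2,3)[of y] by (simp_all add: pos_def)
qed

text \<open>A move of q rows changes \<open>downs\<close> by 1 and x by p; a move of p rows changes
  \<open>ups\<close> by 1 and x by q. Either way x and \<open>ups y * q + downs y * p\<close> change
  by the same amount up to sign.\<close>

lemma hop_coords:
  assumes "hop p q (board m n) (x, y) (x', y')" "m < p + q"
  shows "(even (x + ups y * q + downs y * p) \<longleftrightarrow> even (x' + ups y' * q + downs y' * p)) \<and>
    \<bar>pos y' - pos y\<bar> = 1"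
proof -
  have b: "0 \<le> y" "y < m" "0 \<le> y'" "y' < m"
    and adj: "(\<bar>x - x'\<bar> = p \<and> \<bar>y - y'\<bar> = q) \<or> (\<bar>x - x'\<bar> = q \<and> \<bar>y - y'\<bar> = p)"
    using assms(1) by (auto simp: hop_def leaper_adj_iff)
  define w where "w y = ups y * q + downs y * p" for y
  have w: "even (x + ups y * q + downs y * p) \<longleftrightarrow> even (x + w y)" for x y by (simp only: w_def add.assoc)
  have par: "even (x + A) \<longleftrightarrow> even (x' + A')" if "x' = x + k \<or> x' = x - k" "A' = A + k \<or> A' = A - k" for k A A'
    using that by auto
  have "(w y' = w y + p \<or> w y' = w y - p) \<and> \<bar>pos y' - pos y\<bar> = 1 \<and> (x' = x + p \<or> x' = x - p) \<or>
    (w y' = w y + q \<or> w y' = w y - q) \<and> \<bar>pos y' - pos y\<bar> = 1 \<and> (x' = x + q \<or> x' = x - q)"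
    using adj
  proof
    assume *: "\<bar>x - x'\<bar> = p \<and> \<bar>y - y'\<bar> = q"
    have d: "w (z + q) = w z - p" "pos (z + q) = pos z - 1" for z
      unfolding w_def pos_def coords_down by (simp_all add: algebra_simps)
    have "y' = y + q \<or> y = y' + q" using * by linarith
    then have "(w y' = w y + p \<or> w y' = w y - p) \<and> \<bar>pos y' - pos y\<bar> = 1" using d by auto
    moreover have "x' = x + p \<or> x' = x - p" using * by linarith
    ultimately show ?thesis by simp
  next
    assume *: "\<bar>x - x'\<bar> = q \<and> \<bar>y - y'\<bar> = p"
    have d: "w (z + p) = w z + q" "pos (z + p) = pos z + 1" if "0 \<le> z" "z + p < m" for z
      using coords_up[of z] that assms(2) unfolding w_def pos_def by (simp_all add: algebra_simps)
    have "y' = y + p \<or> y = y' + p" using * by linarith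
    then have "(w y' = w y + q \<or> w y' = w y - q) \<and> \<bar>pos y' - pos y\<bar> = 1" using d b by auto
    moreover have "x' = x + q \<or> x' = x - q" using * by linarith
    ultimately show ?thesis by simp
  qed
  then show ?thesis unfolding w using par by blast
qed

text \<open>The second claim is a discrete intermediate value property: each move changes the
  position by one.\<close>

lemma conn_coords:
  assumes "conn p q (board m n) (x, y) (x', y')" "(x, y) \<in> board m n" "m < p + q"
  shows "even (x + ups y * q + downs y * p) \<longleftrightarrow> even (x' + ups y' * q + downs y' * p)"
    and "min (pos y) (pos y') \<le> k \<Longrightarrow> k \<le> max (pos y) (pos y') \<Longrightarrow> \<exists>z. 0 \<le> z \<and> z < m \<and> pos z = k"
proof -
  have "(even (x + ups y * q + downs y * p) \<longleftrightarrow> even (fst v + ups (snd v) * q + downs (snd v) * p)) \<and>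
    (\<forall>k. min (pos y) (pos (snd v)) \<le> k \<and> k \<le> max (pos y) (pos (snd v)) \<longrightarrow> (\<exists>z. 0 \<le> z \<and> z < m \<and> pos z = k))"
    if "conn p q (board m n) (x, y) v" for v
    using that
  proof (induction rule: rtranclp_induct)
    case base
    then show ?case using assms(2) by auto
  next
    case (step v w)
    obtain x1 y1 x2 y2 where vw: "v = (x1, y1)" "w = (x2, y2)" by (metis surj_pair)
    have h: "(even (x1 + ups y1 * q + downs y1 * p) \<longleftrightarrow> even (x2 + ups y2 * q + downs y2 * p))"
      "\<bar>pos y2 - pos y1\<bar> = 1"
      using hop_coords step.hyps(2) assms(3) unfolding vw by blast+
    have y2: "0 \<le> y2" "y2 < m" using step.hyps(2) by (auto simp: hop_def vw)
    have "\<exists>z. 0 \<le> z \<and> z < m \<and> pos z = k" if "min (pos y) (pos y2) \<le> k" "k \<le> max (pos y) (pos y2)" for k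
    proof (cases "k = pos y2")
      case True
      then show ?thesis using y2 by blast
    next
      case False
      then have "min (pos y) (pos y1) \<le> k \<and> k \<le> max (pos y) (pos y1)" using that h(2) by linarith
      then show ?thesis using step.IH vw by simp
    qed
    then show ?case using step.IH h(1) vw by simp
  qed
  from this[OF assms(1)] show
    "even (x + ups y * q + downs y * p) \<longleftrightarrow> even (x' + ups y' * q + downs y' * p)"
    "min (pos y) (pos y') \<le> k \<Longrightarrow> k \<le> max (pos y) (pos y') \<Longrightarrow> \<exists>z. 0 \<le> z \<and> z < m \<and> pos z = k"
    by simp_all
qed

lemma wazir_imp_vertically_connected:
  assumes "wazir_connected p q (board m n)" "m < p + q"
  shows "vertically_connected p q (board m n)"
proof -
  obtain x y x' y' where w: "(x, y) \<in> board m n" "conn p q (board m n) (x, y) (x', y')"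
    "leaper_adj 0 1 (x, y) (x', y')"
    using assms(1) unfolding wazir_connected_def by (metis surj_pair)
  have "\<not> (y' = y \<and> \<bar>x - x'\<bar> = 1)"
  proof
    assume *: "y' = y \<and> \<bar>x - x'\<bar> = 1"
    have "even (x + b + d) = even (x' + b + d) \<Longrightarrow> even x = even x'" for b d by presburger
    then have "even x = even x'" using conn_coords(1)[OF w(2,1) assms(2)] * by blast
    moreover have "x' = x + 1 \<or> x' = x - 1" using * by linarith
    ultimately show False by auto
  qed
  then have "x' = x \<and> (y' = y + 1 \<or> y = y' + 1)" using w(3) by (auto simp: leaper_adj_iff)
  moreover have "(x', y') \<in> board m n" using conn_mem w by blast
  ultimately show ?thesis unfolding vertically_connected_def using w conn_sym by blast
qed

text \<open>
Missing rows occupy multiples of a + b on the cycle, and so every arc of length a + b that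
avoids them has to lie between two of them.
\<close>

lemma arc_bound:
  assumes vc: "vertically_connected p q (board m n)" "m < p + q"
    and ab: "a * p - b * q = \<sigma>" "\<sigma> = 1 \<or> \<sigma> = -1" "even (a * q + b * p)" "0 < a" "a \<le> q" "0 \<le> b"
  shows "\<exists>i \<ge> 1. p + q - m \<le> i \<and> i * (a + b) \<le> p + q - 2"
proof -
  define R where "R = a + b"
  have R: "0 < R" using ab by (simp add: R_def)
  obtain x y where xy: "(x, y) \<in> board m n" "conn p q (board m n) (x, y) (x, y + 1)"
    using vc(1) by (auto simp: vertically_connected_def)
  have xy': "(x, y + 1) \<in> board m n" using conn_mem xy by blast
  \<comment> \<open>The deviation of the two coordinate differences from \<sigma> (a, b) is k (q, p)
    for some k. The parity invariant makes k even, and the range of \<open>ups\<close> leaves only k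
    = 0.\<close>
  define t where "t = ups (y + 1) - ups y - \<sigma> * a"
  define s where "s = downs (y + 1) - downs y - \<sigma> * b"
  have "\<sigma> * (a * p - b * q) = 1" unfolding ab(1) using ab(2) by auto
  then have e: "t * p = s * q" using coords(1)[of y] coords(1)[of "y + 1"]
    by (simp add: t_def s_def algebra_simps)
  have "q dvd t * p" using e by simp
  then have "q dvd t" using coprime by (simp add: coprime_commute coprime_dvd_mult_left_iff)
  then obtain k where k: "t = k * q" by (metis dvd_def mult.commute)
  then have s: "s = k * p" using e pq by (simp add: algebra_simps)
  have "even (x + a + b) = even (x + c + d) \<Longrightarrow> even (c + d - (a + b))" for a b c d :: int by presburger
  then have "even (ups (y + 1) * q + downs (y + 1) * p - (ups y * q + downs y * p))"
    using conn_coords(1)[OF xy(2,1) vc(2)] by blast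
  also have "ups (y + 1) * q + downs (y + 1) * p - (ups y * q + downs y * p) = t * q + s * p + \<sigma> * (a * q + b * p)"
    by (simp add: t_def s_def algebra_simps)
  finally have "even (t * q + s * p)" using ab(3) by (metis dvd_add_left_iff dvd_mult)
  also have "t * q + s * p = k * (q * q + p * p)" unfolding k s by (simp add: algebra_simps)
  finally have "even k" using odd_sum by auto
  moreover have "\<bar>\<sigma> * a\<bar> = a" using ab by auto
  then have "\<bar>t\<bar> < 2 * q" using coords(2,3)[of y] coords(2,3)[of "y + 1"] ab(5) unfolding t_def by linarith
  then have "\<bar>k\<bar> < 2" using pq by (simp add: k abs_mult)
  ultimately have "k = 0" by presburger
  then have D: "pos (y + 1) = pos y + \<sigma> * R" using k s unfolding t_def s_def pos_def R_def
    by (simp add: algebra_simps)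
  define lo where "lo = min (pos y) (pos (y + 1))"
  have hi: "max (pos y) (pos (y + 1)) = lo + R" using D ab(2) R by (auto simp: lo_def)
  have lo: "1 \<le> lo" "lo + R < p + q"
    using pos_bounds[of y] pos_bounds[of "y + 1"] xy xy' vc(2) hi unfolding lo_def by auto
  have hit: "\<exists>z. 0 \<le> z \<and> z < m \<and> pos z = k" if "lo \<le> k" "k \<le> lo + R" for k
    by (rule conn_coords(2)[OF xy(2,1) vc(2)]) (use that hi in \<open>simp_all add: lo_def\<close>)
  have ceil: "\<exists>i. l \<le> i * R \<and> i * R < l + R" for l
  proof -
    have "(l + R - 1) div R * R \<le> l + R - 1" "l + R - 1 < (l + R - 1) div R * R + R"
      using R pos_mod_sign[of R "l + R - 1"] pos_mod_bound[of R "l + R - 1"]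
        div_mult_mod_eq[of "l + R - 1" R] by linarith+
    then show ?thesis by (intro exI[of _ "(l + R - 1) div R"]) linarith
  qed
  \<comment> \<open>Hence position i R for \<sigma> = -1, and p + q - i R for \<sigma> = 1, belongs
    to the row congruent to -1 - i modulo p + q. The arc meets such a position; that row is present,
    so i is at least the number of missing rows.\<close>
  have Rp: "R * p = \<sigma> + b * (p + q)" using ab(1) by (simp add: R_def algebra_simps)
  have row: "p + q - m \<le> i" if "1 \<le> i" "i * R \<le> p + q - 2" "0 \<le> z" "z < m" "z + 1 = - i + w * (p + q)" for i z w
  proof -
    have "i * 1 \<le> i * R" using that(1) R by (intro mult_left_mono) auto
    then have "i < p + q" using that(2) by simp
    have "0 < w * (p + q)" using that(1,3,5) by linarith
    then have "0 < w" using pq by (simp add: zero_less_mult_iff)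
    then have "1 * (p + q) \<le> w * (p + q)" using pq by (intro mult_right_mono) auto
    moreover have "w * (p + q) = z + 1 + i" using that(5) by simp
    ultimately have "p + q \<le> z + 1 + i" by simp
    then show ?thesis using that(4) by simp
  qed
  show ?thesis
  proof (cases "\<sigma> = 1")
    case False
    then have \<sigma>: "\<sigma> = -1" using ab(2) by simp
    obtain i where i: "lo \<le> i * R" "i * R < lo + R" using ceil by blast
    then obtain z where z: "0 \<le> z" "z < m" "pos z = i * R" using hit by force
    have "0 < i * R" using i lo by linarith
    then have "1 \<le> i" using R by (simp add: zero_less_mult_iff)
    have "z + 1 = i * (R * p) - downs z * (p + q)" using pos_eq[of z] z(3) by simp
    then have "z + 1 = - i + (i * b - downs z) * (p + q)" unfolding Rp \<sigma> by (simp add: algebra_simps)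
    then have "p + q - m \<le> i" using row[OF \<open>1 \<le> i\<close> _ z(1,2)] i lo by simp
    moreover have "i * R \<le> p + q - 2" using i lo by linarith
    ultimately show ?thesis using \<open>1 \<le> i\<close> unfolding R_def by blast
  next
    case \<sigma>: True
    obtain i where i: "p + q - (lo + R) \<le> i * R" "i * R < p + q - lo" using ceil[of "p + q - (lo + R)"] by auto
    then obtain z where z: "0 \<le> z" "z < m" "pos z = p + q - i * R" using hit[of "p + q - i * R"] by force
    have "0 < i * R" using i lo by linarith
    then have "1 \<le> i" using R by (simp add: zero_less_mult_iff)
    have "z + 1 = (p + q) * p - i * (R * p) - downs z * (p + q)" using pos_eq[of z] z(3) by (simp add: algebra_simps)
    then have "z + 1 = - i + (p - i * b - downs z) * (p + q)" unfolding Rp \<sigma> by (simp add: algebra_simps)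
    then have "p + q - m \<le> i" using row[OF \<open>1 \<le> i\<close> _ z(1,2)] i lo by simp
    moreover have "i * R \<le> p + q - 2" using i lo by linarith
    ultimately show ?thesis using \<open>1 \<le> i\<close> unfolding R_def by blast
  qed
qed

end

text \<open>On at most q rows every move is by q columns and one row, so x - q y is invariant modulo
  2 q; a vertical neighbour differs by q.\<close>

lemma not_vertically_connected_one:
  fixes q :: int
  assumes "0 < q" "m \<le> q"
  shows "\<not> vertically_connected 1 q (board m n)"
proof
  assume "vertically_connected 1 q (board m n)"
  then obtain x y where xy: "conn 1 q (board m n) (x, y) (x, y + 1)"
    by (auto simp: vertically_connected_def)
  have "2 * q dvd (fst v - q * snd v) - (x - q * y)" if "conn 1 q (board m n) (x, y) v" for v
    using that
  proof (induction rule: rtranclp_induct)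
    case (step v w)
    obtain x1 y1 x2 y2 where vw: "v = (x1, y1)" "w = (x2, y2)" by (metis surj_pair)
    have "\<bar>x1 - x2\<bar> = q \<and> \<bar>y1 - y2\<bar> = 1"
      using step.hyps(2) assms by (auto simp: hop_def leaper_adj_iff vw)
    then have "(x2 = x1 + q \<or> x2 = x1 - q) \<and> (y2 = y1 + 1 \<or> y2 = y1 - 1)" by linarith
    then obtain j where "x2 - q * y2 = (x1 - q * y1) + j * (2 * q)"
      by (auto intro: that[of 0] that[of 1] that[of "- 1"] simp: algebra_simps)
    then have e: "(x2 - q * y2) - (x - q * y) = ((x1 - q * y1) - (x - q * y)) + j * (2 * q)" by simp
    show ?case using step.IH unfolding vw fst_conv snd_conv e by (simp add: dvd_add)
  qed simp
  from this[OF xy] have "2 * q dvd q * y - q * (y + 1)" by simp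
  also have "q * y - q * (y + 1) = - q" by (simp add: algebra_simps)
  finally have "2 * q dvd q" by simp
  then show False using assms(1) zdvd_imp_le[of "2 * q" q] by simp
qed


lemma vertically_connected_mono:
  assumes "vertically_connected p q (board m n)" "m \<le> m'" "n \<le> n'"
  shows "vertically_connected p q (board m' n')"
proof -
  obtain x y where xy: "(x, y) \<in> board m n" "conn p q (board m n) (x, y) (x, y + 1)"
    using assms(1) by (auto simp: vertically_connected_def)
  have "conn p q (board m' n') (x, y) (x, y + 1)"
    using conn_map[OF xy(2), where f = "\<lambda>u. u" and p' = p and q' = q and B = "board m' n'"] assms(2,3)
    by (auto simp: hop_def)
  then show ?thesis using xy(1) assms(2,3) unfolding vertically_connected_def by fastforce
qed

section \<open>Even continued fractions\<close>

text \<open>The solutions of the three-term recurrence with arbitrary initial values. All numerators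
  below, their differences and their linear combinations are of this form.\<close>

fun cf_seq :: "(nat \<Rightarrow> int) \<Rightarrow> (nat \<Rightarrow> int) \<Rightarrow> int \<Rightarrow> int \<Rightarrow> nat \<Rightarrow> int" where
  "cf_seq c e a b 0 = a"
| "cf_seq c e a b (Suc 0) = b"
| "cf_seq c e a b (Suc (Suc i)) = c (Suc (Suc i)) * cf_seq c e a b (Suc i) + e (Suc i) * cf_seq c e a b i"

lemma cf_seq_linear:
  "x * cf_seq c e a b i + y * cf_seq c e a' b' i = cf_seq c e (x * a + y * a') (x * b + y * b') i"
proof (induction i rule: induct_nat_012)
  case (ge2 i)
  have "x * cf_seq c e a b (Suc (Suc i)) + y * cf_seq c e a' b' (Suc (Suc i)) =
    c (Suc (Suc i)) * (x * cf_seq c e a b (Suc i) + y * cf_seq c e a' b' (Suc i)) +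
    e (Suc i) * (x * cf_seq c e a b i + y * cf_seq c e a' b' i)"
    by (simp add: algebra_simps)
  then show ?case unfolding ge2 by simp
qed simp_all

text \<open>The Casoratian of two solutions is multiplied by \<open>- e (Suc i)\<close> in each
  step.\<close>

lemma cf_seq_det:
  assumes "\<And>j. 1 \<le> j \<Longrightarrow> j \<le> i \<Longrightarrow> e j = 1 \<or> e j = -1" "a' * b - a * b' = 1 \<or> a' * b - a * b' = (-1 :: int)"
  shows "cf_seq c e a' b' i * cf_seq c e a b (Suc i) - cf_seq c e a b i * cf_seq c e a' b' (Suc i) = 1 \<or>
    cf_seq c e a' b' i * cf_seq c e a b (Suc i) - cf_seq c e a b i * cf_seq c e a' b' (Suc i) = -1"
  using assms(1)
proof (induction i)
  case (Suc i)
  define D where "D = cf_seq c e a' b' i * cf_seq c e a b (Suc i) - cf_seq c e a b i * cf_seq c e a' b' (Suc i)"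
  have "cf_seq c e a' b' (Suc i) * cf_seq c e a b (Suc (Suc i)) -
      cf_seq c e a b (Suc i) * cf_seq c e a' b' (Suc (Suc i)) = - e (Suc i) * D"
    by (simp add: D_def algebra_simps)
  moreover have "D = 1 \<or> D = -1" using Suc unfolding D_def by simp
  moreover have "e (Suc i) = 1 \<or> e (Suc i) = -1" using Suc.prems by simp
  ultimately show ?case by auto
qed (use assms(2) in simp)

locale even_cf =
  fixes c e :: "nat \<Rightarrow> int" and K :: nat
  assumes K: "1 \<le> K" and c: "\<And>i. 1 \<le> i \<Longrightarrow> i \<le> K \<Longrightarrow> even (c i) \<and> 2 \<le> c i"
    and e: "\<And>i. 1 \<le> i \<Longrightarrow> i < K \<Longrightarrow> e i = 1 \<or> e i = -1"
begin

text \<open>The i-th tail is the (\<open>qs (i - 1)\<close>, \<open>qs i\<close>)-leaper, see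
  \<open>is_tail_cf\<close>.\<close>

definition qs :: "nat \<Rightarrow> int" where "qs = cf_seq c e 1 (c 1)"

lemma qs_simps: "qs 0 = 1" "qs (Suc 0) = c 1"
  "qs (Suc (Suc i)) = c (Suc (Suc i)) * qs (Suc i) + e (Suc i) * qs i"
  by (simp_all add: qs_def)

text \<open>Convexity, from coefficients at least 2 and signs of modulus 1: increments never
  decrease. All later comparisons of sizes rest on it.\<close>

lemma cf_seq_diff:
  assumes "Suc (Suc i) \<le> K" "0 \<le> cf_seq c e a b i" "0 \<le> cf_seq c e a b (Suc i)"
  shows "cf_seq c e a b (Suc i) - cf_seq c e a b i \<le> cf_seq c e a b (Suc (Suc i)) - cf_seq c e a b (Suc i)"
proof -
  have "2 * cf_seq c e a b (Suc i) \<le> c (Suc (Suc i)) * cf_seq c e a b (Suc i)"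
    using c[of "Suc (Suc i)"] assms by (intro mult_right_mono) auto
  moreover have "e (Suc i) * cf_seq c e a b i = cf_seq c e a b i \<or> e (Suc i) * cf_seq c e a b i = - cf_seq c e a b i"
    using e[of "Suc i"] assms(1) by auto
  ultimately show ?thesis using assms(2) by (simp only: cf_seq.simps) linarith
qed

lemma cf_seq_mono:
  assumes "j \<le> i" "Suc i \<le> K" "0 \<le> cf_seq c e a b j" "cf_seq c e a b j \<le> cf_seq c e a b (Suc j)"
  shows "cf_seq c e a b j \<le> cf_seq c e a b i \<and>
    cf_seq c e a b (Suc j) - cf_seq c e a b j \<le> cf_seq c e a b (Suc i) - cf_seq c e a b i"
  using assms(1,2)
proof (induction i rule: dec_induct)
  case (step i)
  have IH: "cf_seq c e a b j \<le> cf_seq c e a b i"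
    "cf_seq c e a b (Suc j) - cf_seq c e a b j \<le> cf_seq c e a b (Suc i) - cf_seq c e a b i"
    using step.IH step.prems by auto
  then have "cf_seq c e a b (Suc i) - cf_seq c e a b i \<le> cf_seq c e a b (Suc (Suc i)) - cf_seq c e a b (Suc i)"
    using assms(3,4) step.prems by (intro cf_seq_diff) auto
  then show ?case using IH assms(4) by linarith
qed simp

lemma qs_mono: "j \<le> i \<Longrightarrow> Suc i \<le> K \<Longrightarrow> qs j \<le> qs i \<and> qs (Suc j) - qs j \<le> qs (Suc i) - qs i"
proof (induction j)
  case 0
  then show ?case unfolding qs_def using c[of 1] K by (intro cf_seq_mono) auto
next
  case (Suc j)
  have a: "qs 0 \<le> qs (Suc j) \<and> qs 1 - qs 0 \<le> qs (Suc (Suc j)) - qs (Suc j)"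
    unfolding qs_def using cf_seq_mono[of 0 "Suc j" 1 "c 1"] Suc.prems c[of 1] K by auto
  show ?case unfolding qs_def
    by (rule cf_seq_mono[OF Suc.prems]) (use a c[of 1] K in \<open>auto simp: qs_def\<close>)
qed

lemma qs_less: "Suc i \<le> K \<Longrightarrow> qs i < qs (Suc i)"
  using qs_mono[of 0 i] c[of 1] K by (simp add: qs_simps)

lemma qs_pos: "i \<le> K \<Longrightarrow> 0 < qs i"
proof (induction i)
  case (Suc i)
  then show ?case using qs_less[of i] by simp
qed (simp add: qs_simps)

lemma qs_two_le: "Suc i \<le> K \<Longrightarrow> 2 \<le> qs (Suc i)"
  using qs_less[of i] qs_pos[of i] by simp

lemma qs_parity: "i \<le> K \<Longrightarrow> even (qs i) \<longleftrightarrow> odd i"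
proof (induction i rule: induct_nat_012)
  case 1
  then show ?case using c[of 1] by (simp add: qs_simps)
next
  case (ge2 i)
  then show ?case using c[of "Suc (Suc i)"] e[of "Suc i"] by (auto simp: qs_simps)
qed (auto simp: qs_simps)

text \<open>
al i is the numerator of the continued fraction c i, ..., c 2, so that al i / al (i - 1) is the last convergent
of qs i / qs (i - 1) before the value itself.
\<close>

definition al :: "nat \<Rightarrow> int" where "al = cf_seq c e 0 1"

lemma al_parity: "i \<le> K \<Longrightarrow> even (al i) \<longleftrightarrow> even i"
proof (induction i rule: induct_nat_012)
  case (ge2 i)
  then show ?case using c[of "Suc (Suc i)"] e[of "Suc i"] by (auto simp: al_def)
qed (auto simp: al_def)

lemma det: "Suc i \<le> K \<Longrightarrow> al (Suc i) * qs i - al i * qs (Suc i) = 1 \<or> al (Suc i) * qs i - al i * qs (Suc i) = -1"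
  unfolding al_def qs_def using cf_seq_det[of i e 1 1 0 "c 1" c] e by (auto simp: algebra_simps)

lemma coprime_qs: "Suc i \<le> K \<Longrightarrow> coprime (qs i) (qs (Suc i))"
proof (rule coprimeI)
  fix d assume "Suc i \<le> K" "d dvd qs i" "d dvd qs (Suc i)"
  then have "d dvd al (Suc i) * qs i - al i * qs (Suc i)" by simp
  then show "is_unit d" using det[OF \<open>Suc i \<le> K\<close>] by auto
qed

lemma coprime_leaper_qs: "Suc i \<le> K \<Longrightarrow> coprime_leaper (qs i) (qs (Suc i))"
  by unfold_locales (use qs_pos qs_less coprime_qs qs_parity in auto)

lemma tail_step_qs:
  assumes "Suc (Suc i) \<le> K" "0 < C" "qs i \<le> D"
  shows "\<exists>lam mu. tail_step (qs (Suc i)) (qs (Suc (Suc i))) (qs i) (c (Suc (Suc i))) lam mu C D"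
proof -
  have e: "e (Suc i) = 1 \<or> e (Suc i) = -1" using e assms by simp
  show ?thesis
  proof (intro exI)
    show "tail_step (qs (Suc i)) (qs (Suc (Suc i))) (qs i) (c (Suc (Suc i)))
      (if e (Suc i) = 1 then 0 else qs i) (if e (Suc i) = 1 then qs i else 0) C D"
      by unfold_locales (use qs_pos[of i] qs_less[of i] c[of "Suc (Suc i)"] e assms in \<open>auto simp: qs_simps(3)\<close>)
  qed
qed

lemma lift_qs:
  assumes "j \<le> i" "Suc i \<le> K" "d < qs (Suc j)" "0 \<le> E"
    and "vertically_connected (qs j) (qs (Suc j)) (board (qs j + qs (Suc j) - d) (qs j + qs (Suc j) + E))"
  shows "vertically_connected (qs i) (qs (Suc i)) (board (qs i + qs (Suc i) - d) (qs i + qs (Suc i) + E))"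
  using assms(1,2)
proof (induction i rule: dec_induct)
  case base
  then show ?case using assms(5) by simp
next
  case (step i)
  have "qs (Suc j) \<le> qs (Suc i)" using qs_mono[of "Suc j" "Suc i"] step by simp
  then have "0 < qs (Suc i) - d" using assms(3) by simp
  moreover have "qs i \<le> qs (Suc i) + E" using qs_less[of i] step.prems assms(4) by simp
  ultimately obtain lam mu where "tail_step (qs (Suc i)) (qs (Suc (Suc i))) (qs i) (c (Suc (Suc i))) lam mu
      (qs (Suc i) - d) (qs (Suc i) + E)"
    using tail_step_qs step.prems by blast
  from tail_step.vertically_connected_lift[OF this] show ?case
    using step.IH step.prems by (simp add: algebra_simps)
qed

text \<open>The bounds on d and E yield the conditions of \<open>separator_step\<close> at every
  level above j, because both the terms of \<open>qs\<close> and their increments grow.\<close>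

lemma separator_qs:
  assumes "1 \<le> j" "j \<le> i" "Suc i \<le> K" "1 \<le> d" "d < qs j" "d \<le> qs (Suc j) - qs j" "0 \<le> E" "E \<le> qs (Suc j) - 2"
    and "\<exists>F B. separator (qs j) (qs (Suc j)) (qs j + qs (Suc j) - d) (qs j + qs (Suc j) + E) F B"
  shows "\<exists>F B. separator (qs i) (qs (Suc i)) (qs i + qs (Suc i) - d) (qs i + qs (Suc i) + E) F B"
  using assms(2,3)
proof (induction i rule: dec_induct)
  case base
  then show ?case using assms(9) by simp
next
  case (step i)
  have m: "qs (Suc j) \<le> qs (Suc i)" "qs j \<le> qs i" "qs (Suc j) - qs j \<le> qs (Suc i) - qs i"
    using qs_mono[of "Suc j" "Suc i"] qs_mono[of j i] step by auto
  obtain F B where F: "separator (qs i) (qs (Suc i)) (qs i + qs (Suc i) - d) (qs i + qs (Suc i) + E) F B"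
    using step.IH step.prems by auto
  have q0: "0 < qs i" "qs i < qs (Suc i)" using qs_pos qs_less step.prems by auto
  then have "0 < qs (Suc i) - d" "qs i \<le> qs (Suc i) + E" using m assms by linarith+
  then obtain lam mu where T: "tail_step (qs (Suc i)) (qs (Suc (Suc i))) (qs i) (c (Suc (Suc i))) lam mu
      (qs (Suc i) - d) (qs (Suc i) + E)"
    using tail_step_qs step.prems by blast
  have "separator_step (qs (Suc i)) (qs (Suc (Suc i))) (qs i) (c (Suc (Suc i))) lam mu
      (qs (Suc i) - d) (qs (Suc i) + E) F B"
    unfolding separator_step_def separator_step_axioms_def
    using T F m q0 assms(4-8) by (auto simp: algebra_simps)
  from separator_step.separator_G[OF this] show ?case by (auto simp: algebra_simps)
qed

lemma one_le_diff: "Suc i \<le> K \<Longrightarrow> 1 \<le> qs (Suc i) - qs i"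
  using qs_less[of i] by simp

text \<open>One missing row is enough: boards with fewer rows or columns follow by
  monotonicity.\<close>

lemma separator_shallow:
  assumes "1 \<le> i" "Suc i \<le> K"
  shows "\<exists>F B. separator (qs i) (qs (Suc i)) (qs i + qs (Suc i) - 1) (qs i + qs (Suc i) + (qs 2 - 2)) F B"
proof (rule separator_qs[where j = 1])
  have 2: "Suc (Suc 0) = 2" by simp
  have q2: "qs 2 = c 2 * qs 1 + e 1" using qs_simps(3)[of 0] by (simp add: qs_simps 2)
  obtain F where "separator (qs 1) (qs 2) (qs 1 + qs 2 - 1) (qs 1 + 2 * qs 2 - 2) F 2"
    using base_separator_two[of "qs 1" "c 2" "qs 2" "e 1"] c[of 1] c[of 2] e[of 1] assms q2
    by (auto simp: qs_simps)
  moreover have "qs 1 + 2 * qs 2 - 2 = qs 1 + qs 2 + (qs 2 - 2)" by simp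
  ultimately show "\<exists>F B. separator (qs 1) (qs (Suc 1)) (qs 1 + qs (Suc 1) - 1) (qs 1 + qs (Suc 1) + (qs 2 - 2)) F B"
    unfolding Suc_1 by metis
qed (use assms one_le_diff[of 1] qs_two_le[of 0] qs_two_le[of 1] in \<open>auto simp: numeral_2_eq_2\<close>)

lemma separator_deep:
  assumes "2 \<le> i" "Suc i \<le> K" "e 1 = 1"
  shows "\<exists>F B. separator (qs i) (qs (Suc i)) (qs i + qs (Suc i) - c 1) (qs i + qs (Suc i) + (qs 3 - c 1 - 2)) F B"
proof -
  have q2: "qs 2 = c 2 * c 1 + 1" using assms(3) by (simp add: qs_simps numeral_2_eq_2)
  have q3: "qs 3 = c 3 * qs 2 + e 2 * c 1" by (simp add: qs_simps numeral_3_eq_3 numeral_2_eq_2)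
  have cs: "even (c 1) \<and> 2 \<le> c 1" "even (c 2) \<and> 2 \<le> c 2" "even (c 3) \<and> 2 \<le> c 3" "e 2 = 1 \<or> e 2 = -1"
    using c[of 1] c[of 2] c[of 3] e[of 2] assms by auto
  have "2 * c 1 \<le> c 2 * c 1" using cs by (intro mult_right_mono) auto
  then have c1: "2 * c 1 < qs 2" using q2 by simp
  have "qs 2 - qs 1 \<le> qs 3 - qs 2" using qs_mono[of 1 2] assms by (simp add: numeral_3_eq_3 numeral_2_eq_2)
  then have d: "c 1 \<le> qs 3 - qs 2" using c1 by (simp add: qs_simps)
  obtain F where "separator (qs 2) (qs 3) (qs 2 + qs 3 - c 1) (qs 2 + 2 * qs 3 - c 1 - 2) F 3"
    using base_separator_three[of "c 1" "c 2" "c 3" "qs 2" "qs 3" "e 2"] cs q2 q3 by blast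
  moreover have "qs 2 + 2 * qs 3 - c 1 - 2 = qs 2 + qs 3 + (qs 3 - c 1 - 2)" by simp
  ultimately have "\<exists>F B. separator (qs 2) (qs (Suc 2)) (qs 2 + qs (Suc 2) - c 1)
      (qs 2 + qs (Suc 2) + (qs 3 - c 1 - 2)) F B"
  proof -
    assume "separator (qs 2) (qs 3) (qs 2 + qs 3 - c 1) (qs 2 + 2 * qs 3 - c 1 - 2) F 3"
      and e: "qs 2 + 2 * qs 3 - c 1 - 2 = qs 2 + qs 3 + (qs 3 - c 1 - 2)"
    moreover have "Suc 2 = 3" by simp
    ultimately show ?thesis unfolding e by metis
  qed
  moreover have s: "Suc 2 = 3" and c2: "2 \<le> c 1" using cs by simp_all
  have "1 \<le> c 1" "c 1 < qs 2" "c 1 \<le> qs (Suc 2) - qs 2" "0 \<le> qs 3 - c 1 - 2"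
    "qs 3 - c 1 - 2 \<le> qs (Suc 2) - 2" unfolding s using c1 d c2 by linarith+
  ultimately show ?thesis
    using separator_qs[of 2 i "c 1" "qs 3 - c 1 - 2"] assms(1,2) one_le_numeral by blast
qed

text \<open>The initial value \<open>e 1\<close> makes the term at index 2 equal to 1, so from there
  on these are the numerators of c i, ..., c 3. Then \<open>qs_al_be\<close> expands
  \<open>qs\<close> at its innermost quotient.\<close>

definition be :: "nat \<Rightarrow> int" where "be = cf_seq c e (e 1) 0"

lemma qs_al_be:
  assumes "2 \<le> K"
  shows "qs i = c 1 * al i + e 1 * be i"
proof -
  have "e 1 * e 1 = 1" using e[of 1] assms by auto
  then show ?thesis unfolding qs_def al_def be_def cf_seq_linear by simp
qed

text \<open>The differences of \<open>qs\<close> and \<open>al\<close>, and of \<open>al\<close> and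
  \<open>be\<close>, solve the same recurrence; each inequality is the nonnegativity of an
  increasing solution.\<close>

lemma al_be_bounds:
  assumes "1 \<le> i" "Suc i \<le> K"
  shows "0 < al (Suc i)" "0 \<le> al i" "al (Suc i) \<le> qs (Suc i)"
    "0 \<le> be i" "0 < be (Suc i)" "be i + be (Suc i) \<le> al i + al (Suc i)"
proof -
  have e1: "e 1 * e 1 = 1" using e[of 1] assms by auto
  have be2: "be (Suc (Suc 0)) = 1" using e1 by (simp add: be_def)
  have al: "0 \<le> al i" "al i < al (Suc i)"
    using cf_seq_mono[of 0 i 0 1] assms unfolding al_def by auto
  then show "0 < al (Suc i)" "0 \<le> al i" by auto
  have "al (Suc i) \<le> qs (Suc i)"
  proof -
    have "qs k - al k = cf_seq c e 1 (c 1 - 1) k" for k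
      using cf_seq_linear[of 1 c e 1 "c 1" k "-1" 0 1] by (simp add: qs_def al_def)
    moreover have "0 \<le> cf_seq c e 1 (c 1 - 1) (Suc i)"
      using cf_seq_mono[of 0 i 1 "c 1 - 1"] assms c[of 1] by auto
    ultimately show ?thesis by (metis diff_ge_0_iff_ge)
  qed
  then show "al (Suc i) \<le> qs (Suc i)" .
  have be: "0 \<le> be i" "1 \<le> be (Suc i) - be i"
    using cf_seq_mono[of 1 i "e 1" 0] assms be2 unfolding be_def by auto
  then show "0 \<le> be i" "0 < be (Suc i)" by auto
  have "al k - be k = cf_seq c e (- e 1) 1 k" for k
    using cf_seq_linear[of 1 c e 0 1 k "-1" "e 1" 0] by (simp add: be_def al_def)
  moreover have "0 \<le> cf_seq c e (- e 1) 1 i \<and> 0 \<le> cf_seq c e (- e 1) 1 (Suc i)"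
  proof -
    have "cf_seq c e (- e 1) 1 (Suc 1) = c 2 - 1" using e1 by (simp add: numeral_2_eq_2)
    then show ?thesis using cf_seq_mono[of 1 i "- e 1" 1] assms c[of 2] by auto
  qed
  ultimately show "be i + be (Suc i) \<le> al i + al (Suc i)" by (smt (verit))
qed

theorem wazir_connected_bounds:
  assumes k: "K = Suc k" and w: "wazir_connected (qs k) (qs K) (board m n)" and m: "m < qs k + qs K"
  shows "2 \<le> K \<and> (qs k + qs K - c 1 + 1 \<le> m \<and> qs k + qs K + qs 2 - 1 \<le> n \<or>
    3 \<le> K \<and> e 1 = 1 \<and> qs k + qs K - c 1 \<le> m \<and> qs k + qs K + qs 3 - c 1 - 1 \<le> n)"
proof -
  interpret coprime_leaper "qs k" "qs K" using coprime_leaper_qs[of k] k by simp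
  have v: "vertically_connected (qs k) (qs K) (board m n)"
    by (rule wazir_imp_vertically_connected[OF w m])
  have k1: "1 \<le> k"
  proof (rule ccontr)
    assume "\<not> 1 \<le> k"
    then have "k = 0" by simp
    then have "qs k = 1" by (simp add: qs_simps)
    then show False using not_vertically_connected_one[of "qs K" m n] v m qs_pos[of K] by auto
  qed
  have n: "qs k + qs K + qs 2 - 1 \<le> n"
  proof (rule ccontr)
    assume "\<not> ?thesis"
    then have "vertically_connected (qs k) (qs K) (board (qs k + qs K - 1) (qs k + qs K + (qs 2 - 2)))"
      using vertically_connected_mono[OF v] m by simp
    then show False using separator_shallow[of k] k1 k separator_imp_not_vertically_connected by auto
  qed
  have b: "0 < al K" "0 \<le> al k" "al K \<le> qs K" "0 \<le> be k" "0 < be K" "be k + be K \<le> al k + al K"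
    using al_be_bounds[of k] k1 k by auto
  have "even (al K * qs K + al k * qs k)"
    using al_parity[of K] qs_parity[of K] al_parity[of k] qs_parity[of k] k by auto
  moreover obtain s where "al K * qs k - al k * qs K = s" "s = 1 \<or> s = -1" using det[of k] k by auto
  ultimately obtain i where i: "1 \<le> i" "qs k + qs K - m \<le> i" "i * (al K + al k) \<le> qs k + qs K - 2"
    using arc_bound[OF v m, of "al K" "al k" s] b by auto
  define R where "R = al K + al k"
  have R: "0 < R" using b by (simp add: R_def)
  have M: "qs k + qs K = c 1 * R + e 1 * (be k + be K)"
    using qs_al_be[of k] qs_al_be[of K] k k1 by (simp add: R_def algebra_simps)
  have e1: "e 1 = 1 \<or> e 1 = -1" using e[of 1] k k1 by simp
  have large: "a * R \<le> i * R" if "a \<le> i" for a using that R by simp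
  \<comment> \<open>The remainder in \<open>M\<close> is at most R, so c 1 + 1 multiples of R exceed
    p + q - 2.\<close>
  have ic: "i < c 1 + 1"
  proof (rule ccontr)
    assume "\<not> i < c 1 + 1"
    then have "(c 1 + 1) * R \<le> i * R" by (intro large) simp
    moreover have "(c 1 + 1) * R = c 1 * R + R" by (simp add: algebra_simps)
    moreover have "i * R \<le> c 1 * R + e 1 * (be k + be K) - 2" using i(3) M by (simp add: R_def)
    moreover have "e 1 * (be k + be K) \<le> R" using e1 b unfolding R_def by auto
    ultimately show False by linarith
  qed
  show ?thesis
  proof (cases "qs k + qs K - c 1 + 1 \<le> m")
    case True
    then show ?thesis using n k k1 by simp
  next
    case False
    then have "c 1 \<le> i" "m = qs k + qs K - c 1" using i ic by auto
    \<comment> \<open>All c 1 multiples of R fit below p + q - 1 only if the remainder in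
      \<open>M\<close> is at least 2; for \<open>K = 2\<close> it is 1.\<close>
    then have cR: "c 1 * R \<le> qs k + qs K - 2" using large[of "c 1"] i(3) by (simp add: R_def)
    then have e1': "e 1 = 1" using M e1 b by auto
    have "K \<noteq> 2"
    proof
      assume "K = 2"
      then have "k = Suc 0" "K = Suc (Suc 0)" using k by auto
      then have "be k = 0" "be K = 1" using e1' by (simp_all add: be_def)
      then show False using cR M e1' by simp
    qed
    then have K3: "3 \<le> K" using k k1 by simp
    have "qs k + qs K + qs 3 - c 1 - 1 \<le> n"
    proof (rule ccontr)
      assume "\<not> ?thesis"
      then have "vertically_connected (qs k) (qs K) (board (qs k + qs K - c 1) (qs k + qs K + (qs 3 - c 1 - 2)))"
        using vertically_connected_mono[OF v] \<open>m = _\<close> by simp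
      then show False using separator_deep[of k] K3 k e1' separator_imp_not_vertically_connected by auto
    qed
    then show ?thesis using K3 e1' \<open>m = _\<close> by simp
  qed
qed

end


section \<open>Journeys for one, two and three partial quotients\<close>

text \<open>A sweep of q unit steps crosses the board and, q being even, ends in row 0; a single
  move by q then leads back to the first column, one row higher.\<close>

lemma vertically_connected_one:
  fixes q :: int
  assumes "even q" "0 < q"
  shows "vertically_connected 1 q (board (1 + q) (1 + q))"
proof -
  have "conn 1 q (board (1 + q) (1 + q)) (0, 0 + 0 * q) (q, 0 + 0 * q)"
    by (rule sweep_x[where j = q]) (use assms in auto)
  also have "hop 1 q (board (1 + q) (1 + q)) (q, 0 + 0 * q) (0, 1)"
    using assms by (simp add: hop_def leaper_adj_iff)
  finally have "conn 1 q (board (1 + q) (1 + q)) (0, 0) (0, 0 + 1)" by simp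
  then show ?thesis unfolding vertically_connected_def using assms by fastforce
qed

section \<open>Chains of double jumps\<close>

locale wide_board =
  fixes p q m n :: int
  assumes pq: "0 < p" "p < q" and m: "q < m" and n: "2 * q < n"
begin

abbreviation connected :: "cell \<Rightarrow> cell \<Rightarrow> bool" where
  "connected \<equiv> conn p q (board m n)"

text \<open>
The cells of rows 0 and q in one class: (x, 0) and (x + p, q) are both in the class of x modulo 2 p.
\<close>

definition state :: "int \<Rightarrow> cell" where
  "state g = (g mod p, ((g div p) mod 2) * q)"

lemma connected_state:
  assumes "0 \<le> x" "x < n" "t = 0 \<or> t = 1" "x + t * p = g + 2 * p * i"
  shows "connected (x, t * q) (state g)"
proof -
  define s where "s = (g div p) mod 2"
  have s: "s = 0 \<or> s = 1" by (auto simp: s_def)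
  have g: "g mod p = g - g div p * p" using div_mult_mod_eq[of g p] by linarith
  then have "g mod p = x + (t - g div p - 2 * i) * p" using assms(4) by (simp add: algebra_simps)
  moreover have "even (t + k mod 2 + (t - k - 2 * i))" for k by presburger
  then have "even (t + s + (t - g div p - 2 * i))" unfolding s_def .
  ultimately have "connected (x, 0 + t * q) (g mod p, 0 + s * q)"
    using pos_mod_bound[of p g] pos_mod_sign[of p g] pq m n assms(1-3) s by (intro sweep_x) auto
  then show ?thesis by (simp add: state_def s_def)
qed

lemma state_cong: "state (g + 2 * p * i) = state g"
proof -
  have "g + 2 * p * i = g + (2 * i) * p" by simp
  moreover have "(g + (2 * i) * p) mod p = g mod p" "(g + (2 * i) * p) div p = g div p + 2 * i"
    using pq by simp_all
  ultimately show ?thesis unfolding state_def by (simp only: mod_mult_self2)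
qed

lemma state_eq: "0 \<le> x \<Longrightarrow> x < p \<Longrightarrow> state x = (x, 0)" "0 \<le> x \<Longrightarrow> x < p \<Longrightarrow> state (x + p) = (x, q)"
  by (simp_all add: state_def)

text \<open>Two moves by q in the same direction, through a row p above row 0 or p below row
  q.\<close>

lemma state_jump:
  assumes "g mod p < n - 2 * q"
  shows "connected (state g) (state (g + 2 * q))"
proof -
  define x where "x = g mod p"
  define t where "t = (g div p) mod 2"
  have t: "t = 0 \<or> t = 1" by (auto simp: t_def)
  have x: "0 \<le> x" "x < p" "x + 2 * q < n" using pq assms by (auto simp: x_def)
  have "x + t * p = g + 2 * p * (- (g div p div 2))"
  proof -
    have "k mod 2 = k - 2 * (k div 2)" for k :: int by presburger
    then have "t = g div p - 2 * (g div p div 2)" unfolding t_def .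
    then have "t * p = (g div p - 2 * (g div p div 2)) * p" by (rule arg_cong)
    then have "x + t * p = x + g div p * p - 2 * p * (g div p div 2)" by (simp add: algebra_simps)
    then show ?thesis using div_mult_mod_eq[of g p] by (simp add: x_def)
  qed
  then have e: "x + 2 * q + t * p = g + 2 * q + 2 * p * (- (g div p div 2))" by simp
  have r: "0 \<le> t * q + (1 - 2 * t) * p" "t * q + (1 - 2 * t) * p < m" "0 \<le> t * q" "t * q < m"
    using t pq m by auto
  have "hop p q (board m n) (x, t * q) (x + q, t * q + (1 - 2 * t) * p)"
    using t x r pq by (intro hop_qpI) auto
  moreover have "hop p q (board m n) (x + q, t * q + (1 - 2 * t) * p) (x + 2 * q, t * q)"
    using t x r pq by (intro hop_qpI) auto
  ultimately have "connected (x, t * q) (x + 2 * q, t * q)" by (meson rtranclp.rtrancl_into_rtrancl r_into_rtranclp)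
  also have "connected (x + 2 * q, t * q) (state (g + 2 * q))"
    by (rule connected_state[OF _ _ t e]) (use x pq in auto)
  finally show ?thesis unfolding x_def t_def state_def .
qed

lemma state_chain:
  assumes "\<And>i. i < N \<Longrightarrow> (g + 2 * d * int i) mod p < n - 2 * q" "2 * q = 2 * d + 2 * p * k"
  shows "connected (state g) (state (g + 2 * d * int N))"
  using assms(1)
proof (induction N)
  case (Suc N)
  have "connected (state g) (state (g + 2 * d * int N))" using Suc by simp
  also have "connected (state (g + 2 * d * int N)) (state (g + 2 * d * int N + 2 * q))"
    using Suc.prems by (intro state_jump) simp
  also have "g + 2 * d * int N + 2 * q = g + 2 * d * int (Suc N) + 2 * p * k"
    unfolding assms(2) by (simp add: algebra_simps)
  finally show ?case unfolding state_cong .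
qed simp

end

text \<open>Modulo 2 p a double jump shifts the class by 2 \<epsilon>, so p / 2 of them shift it by
  p and exchange rows 0 and q. The chain uses the residue p - 2, which is available just because 2 q
  + p - 2 is the last column.\<close>

lemma vertically_connected_two:
  fixes p q c \<epsilon> :: int
  assumes p: "even p" "2 \<le> p" and c: "even c" "2 \<le> c" and q: "q = c * p + \<epsilon>" and \<epsilon>: "\<epsilon> = 1 \<or> \<epsilon> = -1"
  shows "vertically_connected p q (board (q + 1) (p + 2 * q - 1))"
proof -
  have "2 * p \<le> c * p" using c p by (intro mult_right_mono) auto
  then have pq: "p < q" using p \<epsilon> unfolding q by linarith
  interpret wide_board p q "q + 1" "p + 2 * q - 1" by unfold_locales (use pq p in auto)
  have q2: "2 * q = 2 * \<epsilon> + 2 * p * c" unfolding q by simp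
  obtain h where h: "p = 2 * h" "1 \<le> h" using p by auto
  show ?thesis
  proof (cases "\<epsilon> = 1")
    case True
    have "connected (state 0) (state (0 + 2 * \<epsilon> * int (nat h)))"
      by (rule state_chain[OF _ q2]) (use h True in auto)
    then have "connected (0, 0) (0, q)" using state_eq[of 0] True h by simp
    also have "1 = q + - c * p" using q True by simp
    then have "connected (0 + 0 * q, q) (0 + 0 * q, 1)"
      by (rule sweep_y[rotated 8]) (use pq p c in auto)
    then have "connected (0, q) (0, 1)" by simp
    finally show ?thesis unfolding vertically_connected_def using pq p by (intro exI[of _ 0]) auto
  next
    case False
    then have e: "\<epsilon> = -1" using \<epsilon> by simp
    have "connected (state (p - 2)) (state (p - 2 + 2 * \<epsilon> * int (nat h)))"
    proof (rule state_chain[OF _ q2])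
      fix i assume "i < nat h"
      then have "0 \<le> p - 2 + 2 * \<epsilon> * int i" "p - 2 + 2 * \<epsilon> * int i < p - 1" using h e by auto
      then show "(p - 2 + 2 * \<epsilon> * int i) mod p < p + 2 * q - 1 - 2 * q" by simp
    qed
    moreover have e': "p - 2 + 2 * \<epsilon> * int (nat h) = (p - 2) + p + 2 * p * (- 1)" using h e by simp
    ultimately have "connected (state (p - 2)) (state (p - 2 + p))"
      unfolding e' state_cong by blast
    then have base: "connected (p - 2, 0) (p - 2, q)"
      using state_eq[of "p - 2"] p by simp
    \<comment> \<open>An odd number of steps, like the single step in \<open>up\<close>: both sweeps
      end in column p - 2 + q, in rows p - 1 and p.\<close>
    have "p - 1 = q + (1 - c) * p" using q e by (simp add: algebra_simps)
    then have down: "connected (p - 2 + 0 * q, q) (p - 2 + 1 * q, p - 1)"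
      by (rule sweep_y[rotated 8]) (use pq p c in auto)
    have up: "connected (p - 2 + 0 * q, 0) (p - 2 + 1 * q, p)"
      by (rule sweep_y[where j = 1]) (use pq p in auto)
    note conn_sym[OF down]
    also have "connected (p - 2 + 0 * q, q) (p - 2 + 0 * q, 0)" using conn_sym[OF base] by simp
    also note up
    finally have "connected (p - 2 + q, p - 1) (p - 2 + q, p - 1 + 1)" by simp
    then show ?thesis unfolding vertically_connected_def using pq p
      by (intro exI[of _ "p - 2 + q"] exI[of _ "p - 1"]) auto
  qed
qed

text \<open>
The chain of 2 c-steps from c - 1 visits only residues modulo p at which a jump by 2 q stays on the board.
\<close>

lemma chain_residue:
  fixes c d p :: int
  assumes c: "2 \<le> c" and d: "even d" "2 \<le> d" and p: "p = d * c + 1" and i: "0 \<le> i" "2 * i < d * c"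
  shows "\<exists>a r. c - 1 + 2 * c * i = r + a * p \<and> 0 \<le> r \<and> r < p - c - 1"
proof -
  obtain h where h: "d = 2 * h" "1 \<le> h" using d by auto
  \<comment> \<open>Since 2 c h = p - 1, every h steps lower the residue by one; a counts these
    rounds and b the steps in the current one.\<close>
  define a where "a = i div h"
  define b where "b = i mod h"
  have b: "0 \<le> b" "b \<le> h - 1" using h by (auto simp: b_def)
  have ib: "i = a * h + b" by (simp add: a_def b_def)
  have "0 \<le> a" using i h by (simp add: a_def pos_imp_zdiv_nonneg_iff)
  have "2 * (a * h) < 2 * (c * h)" using i(2) b(1) unfolding ib h(1) by (simp add: algebra_simps)
  then have "a < c" using h by (simp add: mult_less_cancel_right)
  have "c - 1 + 2 * c * i = (c - 1 - a + 2 * c * b) + a * p"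
    unfolding ib p h(1) by (simp add: algebra_simps)
  moreover have "0 \<le> 2 * c * b" using b c by simp
  moreover have "2 * c * b \<le> 2 * c * (h - 1)" using b c by (intro mult_left_mono) auto
  then have "2 * c * b \<le> p - 1 - 2 * c" unfolding p h(1) by (simp add: algebra_simps)
  ultimately show ?thesis using \<open>0 \<le> a\<close> \<open>a < c\<close> by (intro exI[of _ a] exI[of _ "c - 1 - a + 2 * c * b"]) simp
qed


locale three_tails =
  fixes p q c c' c'' \<epsilon> :: int
  assumes c: "even c" "2 \<le> c" and c': "even c'" "2 \<le> c'" and c'': "even c''" "2 \<le> c''"
    and p: "p = c' * c + 1" and q: "q = c'' * p + \<epsilon> * c" and \<epsilon>: "\<epsilon> = 1 \<or> \<epsilon> = -1"
begin

lemma bounds: "2 * c < p" "2 * p \<le> c'' * p" "p < q" "p + c \<le> q" "2 * c \<le> p - 1" "0 < p" "0 < q"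
proof -
  have "2 * c \<le> c' * c" using c' c by (intro mult_right_mono) auto
  then show cp: "2 * c < p" and "2 * c \<le> p - 1" using p by simp_all
  show qq: "2 * p \<le> c'' * p" using c'' cp c by (intro mult_right_mono) auto
  moreover have \<epsilon>c: "\<epsilon> * c = c \<or> \<epsilon> * c = - c" using \<epsilon> by auto
  ultimately show "p < q" "p + c \<le> q" using cp c unfolding q by linarith+
  show "0 < p" "0 < q" using \<open>p < q\<close> cp c by linarith+
qed

sublocale wide_board p q "p + q - c" "p + 2 * q - c - 1"
  by unfold_locales (use bounds c in auto)

text \<open>The c rows are the difference between q and c'' steps of p. That vertical sweep has even
  length and keeps the column; the horizontal one has odd length and supplies the move by q.\<close>

lemma climb:
  assumes y: "0 \<le> y" "y + 2 * c < p" and x: "0 \<le> x" "x + q < p + 2 * q - c - 1" "0 \<le> x + j * p"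
      "x + j * p + q < p + 2 * q - c - 1" and j: "odd j"
  shows "connected (x, y) (x + j * p, y + c)"
proof -
  have ev: "even (1 + 0 + j)" "even (0 + 1 + j)" using j by auto
  show ?thesis
  proof (cases "\<epsilon> = 1")
  case True
  have "y + c = y + q + (- c'') * p" using True q by simp
  then have 2: "connected (x + j * p + 0 * q, y + q) (x + j * p + 0 * q, y + c)"
    by (rule sweep_y[rotated 8]) (use x y bounds c c'' in auto)
  have 1: "connected (x, y + 0 * q) (x + j * p, y + 1 * q)"
    by (rule sweep_x[OF bounds(6,7) _ _ _ _ _ _ refl ev(2)]) (use x y bounds c in \<open>linarith | simp\<close>)+
  show ?thesis using 1 2 rtranclp_trans[of _ "(x, y)"] by fastforce
next
  case False
  then have e: "y + c + q = y + c'' * p" using \<epsilon> q by auto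
  then have 1: "connected (x + 0 * q, y) (x + 0 * q, y + c + q)"
    by (rule sweep_y[rotated 8]) (use x y bounds c c'' in auto)
  have 2: "connected (x, y + c + 1 * q) (x + j * p, y + c + 0 * q)"
    by (rule sweep_x[OF bounds(6,7) _ _ _ _ _ _ refl ev(1)]) (use x y bounds c in \<open>linarith | simp\<close>)+
  show ?thesis using 1 2 rtranclp_trans[of _ "(x, y)"] by fastforce
  qed
qed

lemma walk:
  assumes "int i < c'" "0 \<le> x" "x < q - c - 1" "s = 0 \<or> s = 1"
  shows "connected (x + s * p, 0) (x + ((s + int i) mod 2) * p, int i * c)"
  using assms(1)
proof (induction i)
  case 0
  then show ?case using assms(4) by auto
next
  case (Suc i)
  define b where "b = (s + int i) mod 2"
  have "(k + 1) mod 2 = 1 - k mod 2 \<and> (k mod 2 = 0 \<or> k mod 2 = 1)" for k :: int by presburger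
  from this[of "s + int i"] have b: "b = 0 \<or> b = 1" "(s + int i + 1) mod 2 = 1 - b"
    unfolding b_def by blast+
  have b': "s + int (Suc i) = s + int i + 1" by simp
  have 1: "connected (x + s * p, 0) (x + b * p, int i * c)" unfolding b_def using Suc by simp
  have "int i * c \<le> (c' - 2) * c" using Suc.prems c by (intro mult_right_mono) auto
  then have "int i * c + 2 * c < p" using p by (simp add: algebra_simps)
  then have 2: "connected (x + b * p, int i * c) (x + b * p + (1 - 2 * b) * p, int i * c + c)"
    by (intro climb) (use assms(2-4) b(1) c bounds in auto)
  have e: "x + b * p + (1 - 2 * b) * p = x + (1 - b) * p" "int i * c + c = int (Suc i) * c"
    by (simp_all add: algebra_simps)
  show ?case using rtranclp_trans[OF 1 2[unfolded e]] unfolding b' b(2) .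
qed

text \<open>There are c' - 1 climbs, an odd number, so the columns x and x + p are
  exchanged.\<close>

lemma walk_top:
  assumes "0 \<le> x" "x < q - c - 1"
  shows "connected (x, 0) (x + p, p - 1 - c)" "connected (x + p, 0) (x, p - 1 - c)"
proof -
  have top: "int (nat (c' - 1)) * c = p - 1 - c" using c' p by (simp add: algebra_simps)
  have n: "int (nat (c' - 1)) = c' - 1" using c' by simp
  have "(0 + (k - 1)) mod 2 = 1 \<and> (1 + (k - 1)) mod 2 = 0" if "even k" for k :: int
    using that by presburger
  from this[OF c'(1)] have odd: "(0 + int (nat (c' - 1))) mod 2 = 1" "(1 + int (nat (c' - 1))) mod 2 = 0"
    unfolding n by blast+
  have "int (nat (c' - 1)) < c'" using n by simp
  from walk[OF this assms, of 0] walk[OF this assms, of 1]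
  show "connected (x, 0) (x + p, p - 1 - c)" "connected (x + p, 0) (x, p - 1 - c)"
    unfolding top odd by simp_all
qed

text \<open>N jumps shift the class by \<epsilon> c (p - 1). As c is even, c p vanishes modulo 2 p
  and a net shift by - \<epsilon> c remains.\<close>

lemma half_period:
  obtains N h where "c = 2 * h" "2 * c * int N = c * (p - 1)"
    "\<And>i. i < N \<Longrightarrow> \<exists>a r. c - 1 + 2 * c * int i = r + a * p \<and> 0 \<le> r \<and> r < p - c - 1"
proof -
  obtain h where h: "c = 2 * h" "1 \<le> h" using c by auto
  define N where "N = nat (c' * h)"
  have "0 \<le> c' * h" using h c' by simp
  then have N: "c' * c = 2 * int N" using h by (simp add: N_def)
  have "\<exists>a r. c - 1 + 2 * c * int i = r + a * p \<and> 0 \<le> r \<and> r < p - c - 1" if "i < N" for i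
    by (rule chain_residue[of c c' p "int i"]) (use c c' p that N in auto)
  moreover have "2 * c * int N = c * (p - 1)" using N p by (simp add: algebra_simps)
  ultimately show ?thesis using that h(1) by blast
qed

lemma jump_period: "2 * q = 2 * (\<epsilon> * c) + 2 * p * c''"
  unfolding q by simp

lemma vertically_connected_plus:
  assumes True: "\<epsilon> = 1"
  shows "vertically_connected p q (board (p + q - c) (p + 2 * q - c - 1))"
proof -
  obtain N h where h: "c = 2 * h" and total: "2 * c * int N = c * (p - 1)"
    and res: "\<And>i. i < N \<Longrightarrow> \<exists>a r. c - 1 + 2 * c * int i = r + a * p \<and> 0 \<le> r \<and> r < p - c - 1"
    by (rule half_period) blast
  have q': "q = c'' * p + c" using q True by simp
  have "connected (state (c - 1)) (state (c - 1 + 2 * (\<epsilon> * c) * int N))"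
  proof (rule state_chain[OF _ jump_period])
    fix i assume "i < N"
    then obtain a r where r: "c - 1 + 2 * c * int i = r + a * p" "0 \<le> r" "r < p - c - 1" using res by blast
    then have "(c - 1 + 2 * c * int i) mod p = r" using c by simp
    then show "(c - 1 + 2 * (\<epsilon> * c) * int i) mod p < p + 2 * q - c - 1 - 2 * q" using r True by simp
  qed
  moreover have e: "c - 1 + 2 * (\<epsilon> * c) * int N = (2 * p - 1) + 2 * p * (h - 1)"
    using True total h by (simp add: algebra_simps)
  ultimately have A: "connected (state (c - 1)) (state (2 * p - 1))" unfolding e state_cong by blast
  have B: "connected (2 * p - 1, 0 * q) (state (2 * p - 1))"
    by (rule connected_state[where i = 0]) (use bounds c in auto)
  have C: "state (c - 1) = (c - 1, 0)" using state_eq(1)[of "c - 1"] c bounds by simp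
  have 1: "connected (2 * p - 1, 0) (c - 1, 0)"
    using rtranclp_trans[OF B conn_sym[OF A]] unfolding C by simp
  have big: "2 * p + c \<le> q" using bounds q' by simp
  have 2: "connected (2 * p - 1 + 1 * q, p) (2 * p - 1 + 0 * q, 0)"
    by (rule sweep_y[where j = "- 1"]) (use bounds c big in auto)
  have "c - 1 < q - c - 1" using bounds by simp
  have 3: "connected (c - 1, 0) (c - 1 + p, p - 1 - c)"
    using walk_top(1)[of "c - 1"] \<open>c - 1 < q - c - 1\<close> c by simp
  have "2 * p - 1 + q = c - 1 + p + (c'' + 1) * p" using q' by (simp add: algebra_simps)
  then have 4: "connected (c - 1 + p, p - 1 - c + 0 * q) (2 * p - 1 + q, p - 1 - c + 1 * q)"
    by (rule sweep_x[rotated 8]) (use bounds c big c'' in auto)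
  have "p - 1 = p - 1 - c + q + - c'' * p" using q' by simp
  then have 5: "connected (2 * p - 1 + 1 * q, p - 1 - c + q) (2 * p - 1 + 1 * q, p - 1)"
    by (rule sweep_y[rotated 8]) (use bounds c big c'' in auto)
  \<comment> \<open>From row p down to row 0, along the chain to column c - 1, up p - 1 - c rows by
    climbing, and finally c rows as q - c'' p: the walk ends one row below its start.\<close>
  note 2
  also have "connected (2 * p - 1 + 0 * q, 0) (c - 1, 0)" using 1 by simp
  also note 3
  also have "connected (c - 1 + p, p - 1 - c) (2 * p - 1 + 1 * q, p - 1 - c + q)" using 4 by simp
  also note 5
  finally have "connected (2 * p - 1 + q, p) (2 * p - 1 + q, p - 1)" by simp
  then have "connected (2 * p - 1 + q, p - 1) (2 * p - 1 + q, p - 1 + 1)"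
    using conn_sym by simp
  moreover have "(2 * p - 1 + q, p - 1) \<in> board (p + q - c) (p + 2 * q - c - 1)"
    using bounds c big by auto
  ultimately show ?thesis unfolding vertically_connected_def by blast
qed

lemma vertically_connected_minus:
  assumes e: "\<epsilon> = -1"
  shows "vertically_connected p q (board (p + q - c) (p + 2 * q - c - 1))"
proof -
  obtain N h where h: "c = 2 * h" and total: "2 * c * int N = c * (p - 1)"
    and res: "\<And>i. i < N \<Longrightarrow> \<exists>a r. c - 1 + 2 * c * int i = r + a * p \<and> 0 \<le> r \<and> r < p - c - 1"
    by (rule half_period) blast
  have q': "q = c'' * p - c" using q e by simp
  have "connected (state (p - 2 * c - 1 + p)) (state (p - 2 * c - 1 + p + 2 * (\<epsilon> * c) * int N))"
  proof (rule state_chain[OF _ jump_period])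
    fix i assume "i < N"
    then obtain a r where r: "c - 1 + 2 * c * int i = r + a * p" "0 \<le> r" "r < p - c - 1" using res by blast
    \<comment> \<open>The chain is the mirror image of the one in \<open>chain_residue\<close>: r
      becomes p - c - 2 - r, again a residue that admits a jump.\<close>
    then have e1: "p - 2 * c - 1 + p + 2 * (\<epsilon> * c) * int i = (p - c - 2 - r) + (1 - a) * p"
      unfolding e by (simp add: algebra_simps)
    have "((p - c - 2 - r) + (1 - a) * p) mod p = p - c - 2 - r" using r c by simp
    then show "(p - 2 * c - 1 + p + 2 * (\<epsilon> * c) * int i) mod p < p + 2 * q - c - 1 - 2 * q"
      unfolding e1 using r by linarith
  qed
  moreover have e': "p - 2 * c - 1 + p + 2 * (\<epsilon> * c) * int N = (p - c - 1 + p) + 2 * p * (- h)"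
    using e total h by (simp add: algebra_simps)
  ultimately have "connected (state (p - 2 * c - 1 + p)) (state (p - c - 1 + p))" unfolding e' state_cong by blast
  then have 1: "connected (p - 2 * c - 1, q) (p - c - 1, q)"
    using state_eq(2)[of "p - 2 * c - 1"] state_eq(2)[of "p - c - 1"] c bounds by simp
  have 2: "connected (p - 2 * c - 1, 0 + 1 * q) (p - 2 * c - 1 + p, 0 + 0 * q)"
    by (rule sweep_x[where j = 1]) (use bounds c in auto)
  have 3: "connected (p - 2 * c - 1 + p, 0) (p - 2 * c - 1, p - 1 - c)"
    using walk_top(2)[of "p - 2 * c - 1"] c bounds by simp
  have "p - c - 1 + q = p - 2 * c - 1 + c'' * p" using q' by simp
  then have 4: "connected (p - 2 * c - 1, p - 1 - c + 0 * q) (p - c - 1 + q, p - 1 - c + 0 * q)"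
    by (rule sweep_x[rotated 8]) (use bounds c c'' in auto)
  have "p - c = q + (1 - c'') * p" using q' by (simp add: algebra_simps)
  then have 5: "connected (p - c - 1 + 0 * q, q) (p - c - 1 + 1 * q, p - c)"
    by (rule sweep_y[rotated 8]) (use bounds c c'' in auto)
  have "connected (p - 2 * c - 1, q) (p - 2 * c - 1 + p, 0)" using 2 by simp
  also note 3
  also have "connected (p - 2 * c - 1, p - 1 - c) (p - c - 1 + q, p - 1 - c)" using 4 by simp
  finally have "connected (p - c - 1 + q, p - 1 - c) (p - 2 * c - 1, q)" by (rule conn_sym)
  also note 1
  also have "connected (p - c - 1, q) (p - c - 1 + q, p - 1 - c + 1)" using 5 by simp
  finally have "connected (p - c - 1 + q, p - 1 - c) (p - c - 1 + q, p - 1 - c + 1)" .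
  moreover have "(p - c - 1 + q, p - 1 - c) \<in> board (p + q - c) (p + 2 * q - c - 1)"
    using bounds c by auto
  ultimately show ?thesis unfolding vertically_connected_def by blast
qed

end

lemma vertically_connected_three:
  fixes p q c c' c'' \<epsilon> :: int
  assumes "even c" "2 \<le> c" "even c'" "2 \<le> c'" "even c''" "2 \<le> c''"
    and "p = c' * c + 1" "q = c'' * p + \<epsilon> * c" "\<epsilon> = 1 \<or> \<epsilon> = -1"
  shows "vertically_connected p q (board (p + q - c) (p + 2 * q - c - 1))"
proof -
  interpret three_tails p q c c' c'' \<epsilon> using assms by unfold_locales
  show ?thesis using assms(9) vertically_connected_plus vertically_connected_minus by blast
qed


context even_cf
begin

lemma connected_square:
  assumes "K = Suc k"
  shows "wazir_connected (qs k) (qs K) (board (qs k + qs K) (qs k + qs K))"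
proof -
  have "vertically_connected (qs 0) (qs (Suc 0)) (board (qs 0 + qs (Suc 0) - 0) (qs 0 + qs (Suc 0) + 0))"
    using vertically_connected_one[of "c 1"] c[of 1] K by (simp add: qs_simps)
  from lift_qs[OF _ _ _ _ this, of k] assms qs_pos[of "Suc 0"] K show ?thesis
    by (auto intro: vertically_connected_imp_wazir)
qed

lemma connected_shallow:
  assumes "K = Suc k" "2 \<le> K"
  shows "wazir_connected (qs k) (qs K) (board (qs k + qs K - c 1 + 1) (qs k + qs K + qs 2 - 1))"
proof -
  have q2: "qs 2 = c 2 * c 1 + e 1" by (simp add: qs_simps numeral_2_eq_2)
  have cs: "even (c 1)" "2 \<le> c 1" "even (c 2)" "2 \<le> c 2" "e 1 = 1 \<or> e 1 = -1"
    using c[of 1] c[of 2] e[of 1] assms by auto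
  have "vertically_connected (c 1) (qs 2) (board (qs 2 + 1) (c 1 + 2 * qs 2 - 1))"
    by (rule vertically_connected_two[OF cs(1-4) q2 cs(5)])
  then have "vertically_connected (qs 1) (qs (Suc 1)) (board (qs 1 + qs (Suc 1) - (c 1 - 1)) (qs 1 + qs (Suc 1) + (qs 2 - 1)))"
    by (simp add: qs_simps(2) numeral_2_eq_2 algebra_simps)
  moreover have "c 1 - 1 < qs (Suc 1)" "0 \<le> qs 2 - 1" "1 \<le> k" "Suc k \<le> K"
    using qs_less[of 1] qs_two_le[of 1] assms by (auto simp: qs_simps(2) numeral_2_eq_2)
  ultimately have "vertically_connected (qs k) (qs (Suc k)) (board (qs k + qs (Suc k) - (c 1 - 1)) (qs k + qs (Suc k) + (qs 2 - 1)))"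
    using lift_qs[of 1 k "c 1 - 1" "qs 2 - 1"] by blast
  moreover have "qs k + qs K - (c 1 - 1) = qs k + qs K - c 1 + 1"
    "qs k + qs K + (qs 2 - 1) = qs k + qs K + qs 2 - 1" by simp_all
  ultimately show ?thesis
    unfolding assms(1)[symmetric] using vertically_connected_imp_wazir by metis
qed

lemma connected_deep:
  assumes "K = Suc k" "3 \<le> K" "e 1 = 1"
  shows "wazir_connected (qs k) (qs K) (board (qs k + qs K - c 1) (qs k + qs K + qs 3 - c 1 - 1))"
proof -
  have q2: "qs 2 = c 2 * c 1 + 1" using assms(3) by (simp add: qs_simps numeral_2_eq_2)
  have q3: "qs 3 = c 3 * qs 2 + e 2 * c 1" by (simp add: qs_simps numeral_3_eq_3 numeral_2_eq_2)
  have cs: "even (c 1)" "2 \<le> c 1" "even (c 2)" "2 \<le> c 2" "even (c 3)" "2 \<le> c 3" "e 2 = 1 \<or> e 2 = -1"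
    using c[of 1] c[of 2] c[of 3] e[of 2] assms by auto
  have "vertically_connected (qs 2) (qs 3) (board (qs 2 + qs 3 - c 1) (qs 2 + 2 * qs 3 - c 1 - 1))"
    by (rule vertically_connected_three[OF cs(1-6) q2 q3 cs(7)])
  then have "vertically_connected (qs 2) (qs (Suc 2)) (board (qs 2 + qs (Suc 2) - c 1) (qs 2 + qs (Suc 2) + (qs 3 - c 1 - 1)))"
    by (simp add: algebra_simps)
  moreover have "c 1 < qs 2" "qs 2 < qs 3"
    using qs_less[of 1] qs_less[of 2] assms by (auto simp: qs_simps(2) numeral_2_eq_2 numeral_3_eq_3)
  then have "c 1 < qs (Suc 2)" "0 \<le> qs 3 - c 1 - 1" by simp_all
  moreover have "2 \<le> k" "Suc k \<le> K" using assms by auto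
  ultimately have "vertically_connected (qs k) (qs (Suc k)) (board (qs k + qs (Suc k) - c 1) (qs k + qs (Suc k) + (qs 3 - c 1 - 1)))"
    using lift_qs[of 2 k "c 1" "qs 3 - c 1 - 1"] by blast
  moreover have "qs k + qs K + (qs 3 - c 1 - 1) = qs k + qs K + qs 3 - c 1 - 1" by simp
  ultimately show ?thesis
    unfolding assms(1)[symmetric] using vertically_connected_imp_wazir by metis
qed

end


section \<open>Conclusion\<close>

lemma is_tail_cf:
  assumes "even_cf c e K" "is_tail c e i p q" "1 \<le> i" "i \<le> K"
  shows "q = even_cf.qs c e i \<and> p = even_cf.qs c e (i - 1)"
proof -
  interpret even_cf c e K by fact
  have val: "1 \<le> j \<Longrightarrow> j \<le> K \<Longrightarrow> ecf_value c e j = of_int (qs j) / of_int (qs (j - 1))" for j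
  proof (induction j rule: induct_nat_012)
    case (ge2 j)
    have pos: "0 < qs (Suc j)" "0 < qs j" using qs_pos ge2.prems by auto
    have v: "ecf_value c e (Suc j) = of_int (qs (Suc j)) / of_int (qs j)" using ge2 by simp
    have w: "(of_int (qs (Suc (Suc j))) :: rat) =
        of_int (c (Suc (Suc j))) * of_int (qs (Suc j)) + of_int (e (Suc j)) * of_int (qs j)"
      by (simp add: qs_simps(3))
    show ?case unfolding ecf_value.simps(3) v diff_Suc_1 w using pos by (simp add: field_simps)
  qed (simp_all add: qs_simps)
  obtain k where k: "i = Suc k" using assms(3) by (cases i) auto
  have pos: "0 < qs k" "0 < qs i" using qs_pos k assms(4) by auto
  have t: "0 < p" "coprime p q" "of_int q / of_int p = (of_int (qs i) / of_int (qs k) :: rat)" "0 < q"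
    using assms(2) val[OF assms(3,4)] k unfolding is_tail_def by (auto simp: coprime_iff_gcd_eq_1)
  then have "(of_int (q * qs k) :: rat) = of_int (qs i * p)" using pos by (simp add: field_simps)
  then have e: "q * qs k = qs i * p" by (simp only: of_int_eq_iff)
  have "coprime (qs k) (qs i)" using coprime_qs[of k] k assms(4) by simp
  have "q dvd qs i * p" using e by (metis dvd_triv_left)
  then have 1: "q dvd qs i" using t(2) by (simp add: coprime_commute coprime_dvd_mult_left_iff)
  have "qs i dvd q * qs k" using e by simp
  then have "qs i dvd q" using \<open>coprime (qs k) (qs i)\<close> by (simp add: coprime_commute coprime_dvd_mult_left_iff)
  then have "q = qs i" using 1 t(4) pos(2) by (simp add: zdvd_antisym_nonneg)
  then show ?thesis using e pos k by simp
qed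

theorem theorem2:
  fixes p q :: int and \<kappa> :: nat and c e P Q :: "nat \<Rightarrow> int"
    and A0 A1 A2 A :: "cell set" and m n :: int
  assumes "0 < p" and "p < q" and "odd (p + q)" and "gcd p q = 1"
    and "is_even_cf p q \<kappa> c e"
    and "\<And>i. 1 \<le> i \<Longrightarrow> i \<le> \<kappa> \<Longrightarrow> is_tail c e i (P i) (Q i)"
    and "is_board (p + q) (p + q) A0"
    and "2 \<le> \<kappa> \<Longrightarrow> is_board (p + q - c 1 + 1) (p + q + Q 2 - 1) A1"
    and "3 \<le> \<kappa> \<Longrightarrow> e 1 = 1 \<Longrightarrow> is_board (p + q - c 1) (p + q + Q 3 - c 1 - 1) A2"
    and "is_board m n A"
  shows "(\<exists>ws. wazir_journey p q A ws) \<longleftrightarrow>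
    (board_le A0 A \<or>
     (2 \<le> \<kappa> \<and> board_le A1 A) \<or>
     (3 \<le> \<kappa> \<and> e 1 = 1 \<and> board_le A2 A))"
proof -
  have "2 \<le> c i" if "even (c i)" "0 < c i" for i using that by presburger
  then have cf: "even_cf c e \<kappa>"
    using assms(5) unfolding is_even_cf_def by unfold_locales auto
  interpret even_cf c e \<kappa> by fact
  obtain k where k: "\<kappa> = Suc k" using K by (cases \<kappa>) auto
  have "is_tail c e \<kappa> p q"
    using assms(1-5) unfolding is_tail_def is_even_cf_def by simp
  then have pq: "q = qs \<kappa>" "p = qs k"
    using is_tail_cf[OF cf] K k by fastforce+
  have Q: "2 \<le> \<kappa> \<Longrightarrow> Q 2 = qs 2" "3 \<le> \<kappa> \<Longrightarrow> Q 3 = qs 3"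
    using is_tail_cf[OF cf assms(6)] by auto
  let ?big = "\<lambda>m n. p + q \<le> m \<and> p + q \<le> n \<or>
    2 \<le> \<kappa> \<and> p + q - c 1 + 1 \<le> m \<and> p + q + qs 2 - 1 \<le> n \<or>
    3 \<le> \<kappa> \<and> e 1 = 1 \<and> p + q - c 1 \<le> m \<and> p + q + qs 3 - c 1 - 1 \<le> n"
  have right: "(board_le A0 A \<or> (2 \<le> \<kappa> \<and> board_le A1 A) \<or> (3 \<le> \<kappa> \<and> e 1 = 1 \<and> board_le A2 A)) \<longleftrightarrow>
      ?big m n \<or> ?big n m"
    using board_le_iff[OF assms(7) assms(10)] board_le_iff[OF assms(8) assms(10)]
      board_le_iff[OF assms(9) assms(10)] Q by (smt (verit))
  have suff: "wazir_connected p q (board m n)" if "?big m n" for m n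
    using that
  proof (elim disjE conjE)
    assume "p + q \<le> m" "p + q \<le> n"
    then show ?thesis using connected_square[OF k] wazir_connected_mono unfolding pq by blast
  next
    assume "2 \<le> \<kappa>" "p + q - c 1 + 1 \<le> m" "p + q + qs 2 - 1 \<le> n"
    then show ?thesis using connected_shallow[OF k] wazir_connected_mono unfolding pq by blast
  next
    assume "3 \<le> \<kappa>" "e 1 = 1" "p + q - c 1 \<le> m" "p + q + qs 3 - c 1 - 1 \<le> n"
    then show ?thesis using connected_deep[OF k] wazir_connected_mono unfolding pq by blast
  qed
  have nec: "?big m n" if "wazir_connected p q (board m n)" "m < p + q" for m n
    using wazir_connected_bounds[OF k, of m n] that unfolding pq by blast
  have "wazir_connected p q (board m n) \<longleftrightarrow> ?big m n \<or> ?big n m"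
  proof
    assume w: "wazir_connected p q (board m n)"
    show "?big m n \<or> ?big n m"
    \<comment> \<open>The necessary condition needs a short vertical side; transposition provides it
      unless both sides are at least p + q.\<close>
    proof (cases "m < p + q")
      case True
      then show ?thesis using nec[OF w] by blast
    next
      case m: False
      show ?thesis
      proof (cases "n < p + q")
        case True
        then show ?thesis using nec[OF wazir_connected_swap[OF w]] by blast
      qed (use m in simp)
    qed
  next
    assume "?big m n \<or> ?big n m"
    then show "wazir_connected p q (board m n)" using suff[of m n] suff[of n m] wazir_connected_swap by blast
  qed
  then show ?thesis using journey_iff_wazir_connected[OF assms(10)] right by simp
qed



end
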